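(* Let $T:H(\mathbb{C})\rightarrow H(\mathbb{C})$ be a continuous linear operator such that $\ker T\neq\{0\}$ and such that $\left[T,\frac{\mathrm{d}}{\mathrm{d}z}\right]=aI$ for some constant $a\in\mathbb{C}\setminus\{0\}$, where $I$ is the identity operator on $H(\mathbb{C})$. Let $L$ be an entire function such that $L\not\equiv\mathrm{const}$ and $L(T)$ is a continuous operator from $H(\mathbb{C})$ to itself. Then $L(T)$ is hypercyclic.
   Context: $H(\mathbb{C})$ is the space of all entire functions on $\mathbb{C}$ with the topology of uniform convergence on compact subsets of $\mathbb{C}$. For linear operators $A,B$ on $H(\mathbb{C})$, $[A,B]=AB-BA$; $\frac{\mathrm{d}}{\mathrm{d}z}$ is the differentiation operator $f\mapsto f'$ on $H(\mathbb{C})$. For an entire function $L(\lambda)=\sum_{k=0}^\infty d_k\lambda^k$, $L(T)$ denotes the operator $L(T)f=\sum_{k=0}^\infty d_kT^kf$; the hypothesis that $L(T)$ is a continuous operator from $H(\mathbb{C})$ to itself means that this series converges in $H(\mathbb{C})$ for every $f\in H(\mathbb{C})$ and defines a continuous linear operator on $H(\mathbb{C})$. A continuous linear operator $A:X\to X$ on a topological vector space $X$ is called hypercyclic if there exists $x\in X$ such that the orbit $\{A^nx : n=0,1,2,\dots\}$ is dense in $X$. *)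

theory Defs
  imports "HOL-Complex_Analysis.Complex_Analysis"
begin

section \<open>The space of entire functions\<close>

typedef entire = "{f :: complex \<Rightarrow> complex. f holomorphic_on UNIV}"
  morphisms eval_entire Entire
  by (rule exI[of _ "\<lambda>_. 0"]) simp

setup_lifting type_definition_entire

lemma entire_eqI: "(\<And>z. eval_entire f z = eval_entire g z) \<Longrightarrow> f = g"
  by transfer auto

instantiation entire :: ab_group_add
begin

lift_definition zero_entire :: entire is "\<lambda>_. 0"
  by simp

lift_definition plus_entire :: "entire \<Rightarrow> entire \<Rightarrow> entire" is "\<lambda>f g z. f z + g z"
  by (rule holomorphic_on_add)

lift_definition minus_entire :: "entire \<Rightarrow> entire \<Rightarrow> entire" is "\<lambda>f g z. f z - g z"
  by (rule holomorphic_on_diff)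

lift_definition uminus_entire :: "entire \<Rightarrow> entire" is "\<lambda>f z. - f z"
  by (rule holomorphic_on_minus)

instance
  by standard (transfer; simp add: algebra_simps)+

end

text \<open>There is no type class for complex vector spaces, so scalar multiplication is an explicit
  operation in the sense of the locale \<open>vector_space\<close>.\<close>

lift_definition scale_entire :: "complex \<Rightarrow> entire \<Rightarrow> entire" is "\<lambda>c f z. c * f z"
  by (rule holomorphic_on_mult) auto

lemma vector_space_entire: "vector_space scale_entire"
  by standard (transfer; simp add: algebra_simps)+

text \<open>The topology of uniform convergence on compact sets: the sets
  \<open>{g. \<forall>z\<in>K. dist (g z) (f z) < e}\<close> with \<open>K\<close> compact and \<open>e > 0\<close> form a neighbourhood base at \<open>f\<close>.
  Lemma \<open>tendsto_entire_iff\<close> below confirms that it has the intended convergence.\<close>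

instantiation entire :: t2_space
begin

definition open_entire :: "entire set \<Rightarrow> bool" where
  "open_entire U \<longleftrightarrow> (\<forall>f\<in>U. \<exists>K e. compact K \<and> e > 0 \<and>
     {g. \<forall>z\<in>K. dist (eval_entire g z) (eval_entire f z) < e} \<subseteq> U)"

instance
proof
  show "open (UNIV :: entire set)"
    unfolding open_entire_def by (auto intro!: exI[of _ "{}"] exI[of _ 1])
next
  fix S T :: "entire set"
  assume S: "open S" and T: "open T"
  show "open (S \<inter> T)"
    unfolding open_entire_def
  proof
    fix f assume f: "f \<in> S \<inter> T"
    obtain K1 e1 where 1: "compact K1" "e1 > 0"
      "{g. \<forall>z\<in>K1. dist (eval_entire g z) (eval_entire f z) < e1} \<subseteq> S"
      using S f unfolding open_entire_def by blast
    obtain K2 e2 where 2: "compact K2" "e2 > 0"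
      "{g. \<forall>z\<in>K2. dist (eval_entire g z) (eval_entire f z) < e2} \<subseteq> T"
      using T f unfolding open_entire_def by blast
    show "\<exists>K e. compact K \<and> e > 0 \<and>
        {g. \<forall>z\<in>K. dist (eval_entire g z) (eval_entire f z) < e} \<subseteq> S \<inter> T"
      by (rule exI[of _ "K1 \<union> K2"], rule exI[of _ "min e1 e2"])
         (use 1 2 in \<open>auto intro: compact_Un\<close>)
  qed
next
  fix \<U> :: "entire set set"
  assume "\<forall>S\<in>\<U>. open S"
  then show "open (\<Union>\<U>)"
    unfolding open_entire_def by (meson Union_iff Union_upper subset_trans)
next
  fix f g :: entire
  assume "f \<noteq> g"
  then obtain w where w: "eval_entire f w \<noteq> eval_entire g w"
    using entire_eqI by blast
  have op: "open {h. eval_entire h w \<in> B}" if "open B" for B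
    unfolding open_entire_def
  proof
    fix h assume "h \<in> {h. eval_entire h w \<in> B}"
    then obtain e where "e > 0" "\<And>y. dist y (eval_entire h w) < e \<Longrightarrow> y \<in> B"
      using \<open>open B\<close> unfolding open_dist by auto
    then show "\<exists>K e. compact K \<and> e > 0 \<and>
        {g. \<forall>z\<in>K. dist (eval_entire g z) (eval_entire h z) < e} \<subseteq> {h. eval_entire h w \<in> B}"
      by (intro exI[of _ "{w}"] exI[of _ e]) auto
  qed
  obtain A B where AB: "open A" "open B" "eval_entire f w \<in> A" "eval_entire g w \<in> B" "A \<inter> B = {}"
    using hausdorff[OF w] by blast
  show "\<exists>U V. open U \<and> open V \<and> f \<in> U \<and> g \<in> V \<and> U \<inter> V = {}"
    by (rule exI[of _ "{h. eval_entire h w \<in> A}"], rule exI[of _ "{h. eval_entire h w \<in> B}"])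
       (use op AB in auto)
qed

end

lemma open_entire_ball:
  assumes "compact K" and "e > 0"
  shows "\<exists>U. open U \<and> f \<in> U \<and> U \<subseteq> {g. \<forall>z\<in>K. dist (eval_entire g z) (eval_entire f z) < e}"
proof -
  define U where "U = {g. \<exists>r<e. \<forall>z\<in>K. dist (eval_entire g z) (eval_entire f z) \<le> r}"
  have "open U"
    unfolding open_entire_def
  proof
    fix g assume "g \<in> U"
    then obtain r where r: "r < e" "\<forall>z\<in>K. dist (eval_entire g z) (eval_entire f z) \<le> r"
      unfolding U_def by blast
    define d where "d = (e - r) / 2"
    have d: "d > 0" "r + d < e"
      using r by (auto simp: d_def field_simps)
    have "dist (eval_entire h z) (eval_entire f z) \<le> r + d"
      if "\<forall>z\<in>K. dist (eval_entire h z) (eval_entire g z) < d" "z \<in> K" for h z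
      using that r(2) dist_triangle[of "eval_entire h z" "eval_entire f z" "eval_entire g z"]
      by fastforce
    then have "{h. \<forall>z\<in>K. dist (eval_entire h z) (eval_entire g z) < d} \<subseteq> U"
      unfolding U_def using d(2) by blast
    with \<open>compact K\<close> d(1) show "\<exists>K e. compact K \<and> e > 0 \<and>
        {h. \<forall>z\<in>K. dist (eval_entire h z) (eval_entire g z) < e} \<subseteq> U"
      by blast
  qed
  moreover have "f \<in> U"
    unfolding U_def using \<open>e > 0\<close> by auto
  moreover have "U \<subseteq> {g. \<forall>z\<in>K. dist (eval_entire g z) (eval_entire f z) < e}"
    unfolding U_def by fastforce
  ultimately show ?thesis by blast
qed

lemma tendsto_entire_iff:
  "(F \<longlongrightarrow> f) net \<longleftrightarrow>
     (\<forall>K. compact K \<longrightarrow> uniform_limit K (\<lambda>n. eval_entire (F n)) (eval_entire f) net)"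
proof (intro iffI allI impI)
  fix K :: "complex set"
  assume lim: "(F \<longlongrightarrow> f) net" and K: "compact K"
  show "uniform_limit K (\<lambda>n. eval_entire (F n)) (eval_entire f) net"
    unfolding uniform_limit_iff
  proof (intro allI impI)
    fix e :: real assume "e > 0"
    then obtain U where U: "open U" "f \<in> U"
      "U \<subseteq> {g. \<forall>z\<in>K. dist (eval_entire g z) (eval_entire f z) < e}"
      using open_entire_ball[OF K] by blast
    show "\<forall>\<^sub>F n in net. \<forall>z\<in>K. dist (eval_entire (F n) z) (eval_entire f z) < e"
      using topological_tendstoD[OF lim U(1,2)] by eventually_elim (use U(3) in auto)
  qed
next
  assume *: "\<forall>K. compact K \<longrightarrow> uniform_limit K (\<lambda>n. eval_entire (F n)) (eval_entire f) net"
  show "(F \<longlongrightarrow> f) net"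
  proof (rule topological_tendstoI)
    fix U assume "open U" "f \<in> U"
    then obtain K e where K: "compact K" "e > 0"
      "{g. \<forall>z\<in>K. dist (eval_entire g z) (eval_entire f z) < e} \<subseteq> U"
      unfolding open_entire_def by blast
    have "\<forall>\<^sub>F n in net. \<forall>z\<in>K. dist (eval_entire (F n) z) (eval_entire f z) < e"
      using * K(1,2) unfolding uniform_limit_iff by blast
    then show "\<forall>\<^sub>F n in net. F n \<in> U"
      by eventually_elim (use K(3) in auto)
  qed
qed

lift_definition deriv_entire :: "entire \<Rightarrow> entire" is deriv
  by (rule holomorphic_deriv) auto


section \<open>Operators\<close>

definition commutator :: "('a::ab_group_add \<Rightarrow> 'a) \<Rightarrow> ('a \<Rightarrow> 'a) \<Rightarrow> 'a \<Rightarrow> 'a" where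
  "commutator A B = (\<lambda>x. A (B x) - B (A x))"

definition continuous_linear_operator ::
    "('k::field \<Rightarrow> 'a::{ab_group_add, topological_space} \<Rightarrow> 'a) \<Rightarrow> ('a \<Rightarrow> 'a) \<Rightarrow> bool" where
  "continuous_linear_operator smul A \<longleftrightarrow>
     Vector_Spaces.linear smul smul A \<and> continuous_on UNIV A"

definition hypercyclic ::
    "('k::field \<Rightarrow> 'a::{ab_group_add, topological_space} \<Rightarrow> 'a) \<Rightarrow> ('a \<Rightarrow> 'a) \<Rightarrow> bool" where
  "hypercyclic smul A \<longleftrightarrow>
     continuous_linear_operator smul A \<and>
     (\<exists>x. closure (range (\<lambda>n::nat. (A ^^ n) x)) = UNIV)"

text \<open>The terms \<open>d\<^sub>k T\<^sup>k f\<close> of the series \<open>L(T) f\<close>, where \<open>d\<^sub>k\<close> are the Taylor coefficients of \<open>L\<close> at \<open>0\<close>.\<close>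

definition op_series_term ::
    "(complex \<Rightarrow> complex) \<Rightarrow> (entire \<Rightarrow> entire) \<Rightarrow> entire \<Rightarrow> nat \<Rightarrow> entire" where
  "op_series_term L T f k = scale_entire (fps_nth (fps_expansion L 0) k) ((T ^^ k) f)"

text \<open>\<open>L(T)\<close>. The value is meaningful only if the series converges in the topology of \<open>entire\<close>.\<close>

definition entire_of_op ::
    "(complex \<Rightarrow> complex) \<Rightarrow> (entire \<Rightarrow> entire) \<Rightarrow> entire \<Rightarrow> entire" where
  "entire_of_op L T f = (\<Sum>k. op_series_term L T f k)"

end

(* If T f = 0, then T f^(n) = a n f^(n-1), so T acts on the translate f(. + c) = sum c^n/n! f^(n) as
   multiplication by a c, and L(T) as multiplication by L(a c). By the Godefroy-Shapiro criterion it
   suffices that the translates by c in a nonempty open set span a dense subspace, and for this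
   that the closed span M of the derivatives of f is the whole space. Evaluating
   T f(. + w) = a w f(. + w) at 0 and expanding f(. + w) in powers of z writes a w f(w) as a series
   in the f^(n)(w), so z f lies in M. Hence M is a closed ideal invariant under differentiation.
   On a disc f = p g with p a polynomial and g zero-free, so M approximates f/g = p there, and
   differentiating deg p times it approximates, hence contains, the constant 1. *)

theory Submission
  imports Defs
begin

section \<open>Entire functions as a topological vector space\<close>

text \<open>No explicit form of T is used. Besides the commutation relation and T f = 0, only the
  functional sending g to (T g)(0) enters. Its continuity bounds its values on z^n by C S^n, and
  this growth bound turns the identity for a w f(w), pointwise in w, into a series that converges in
  H(C). Only then does z f lie in M. Leibniz' rule carries the membership over to the z f^(n), which
  makes M stable under multiplication by z. The polynomial p depends on the disc, and 1/g may have
  poles outside it, so f/g = p is not obtained as an element of M. A Taylor polynomial q of 1/g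
  takes its place: q f lies in M and is close to p, and Cauchy's inequality, at the price of a
  smaller disc, makes its derivative of order deg p close to a nonzero constant. The open sets fed
  into the criterion are the preimages of the unit disc and of its exterior under the map from c to
  L(a c); they are nonempty by Liouville's theorem for L and for 1/L. The topology comes from
  neighbourhoods and not from a metric, so the Baire argument runs on supremum balls over growing
  discs.\<close>

interpretation entire: vector_space scale_entire
  by (rule vector_space_entire)

lemma eval_entire_simps [simp]:
  "eval_entire 0 = (\<lambda>z. 0)"
  "eval_entire (f + g) = (\<lambda>z. eval_entire f z + eval_entire g z)"
  "eval_entire (f - g) = (\<lambda>z. eval_entire f z - eval_entire g z)"
  "eval_entire (- f) = (\<lambda>z. - eval_entire f z)"
  "eval_entire (scale_entire c f) = (\<lambda>z. c * eval_entire f z)"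
  "eval_entire (deriv_entire f) = deriv (eval_entire f)"
  by (transfer, simp)+

lemma eval_entire_sum [simp]: "eval_entire (sum F A) = (\<lambda>z. \<Sum>x\<in>A. eval_entire (F x) z)"
  by (induction A rule: infinite_finite_induct) auto

lemma holomorphic_eval_entire [simp]: "eval_entire f holomorphic_on S"
  using eval_entire[of f] holomorphic_on_subset by blast

lemma continuous_eval_entire [simp]: "continuous_on S (eval_entire f)"
  by (simp add: holomorphic_on_imp_continuous_on)

lemma eval_entire_funpow_deriv [simp]:
  "eval_entire ((deriv_entire ^^ n) f) = (deriv ^^ n) (eval_entire f)"
  by (induction n) auto

lemma compact_subset_cball_0:
  fixes K :: "complex set"
  assumes "compact K"
  obtains R where "K \<subseteq> cball 0 R" "R > 0"
proof -
  obtain R where "R > 0" "\<And>z. z \<in> K \<Longrightarrow> norm z \<le> R"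
    using compact_imp_bounded[OF assms] bounded_pos by metis
  then show thesis by (intro that[of R]) auto
qed

lemma eval_entire_bound:
  obtains B where "B > 0" "\<And>z. norm z \<le> R \<Longrightarrow> norm (eval_entire f z) \<le> B"
proof -
  have "bounded (eval_entire f ` cball 0 R)"
    by (intro compact_imp_bounded compact_continuous_image) auto
  then show thesis
    using that by (fastforce simp: bounded_pos)
qed

text \<open>Every compact set lies in a closed disc about the origin, so these discs are enough; the
  later estimates are made on them.\<close>

lemma tendsto_entire_cball:
  "(F \<longlongrightarrow> f) net \<longleftrightarrow> (\<forall>R. uniform_limit (cball 0 R) (\<lambda>n. eval_entire (F n)) (eval_entire f) net)"
  unfolding tendsto_entire_iff
  by (meson compact_cball compact_subset_cball_0 uniform_limit_on_subset)

lemma tendsto_eval_entire: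
  assumes "(F \<longlongrightarrow> f) net"
  shows "((\<lambda>n. eval_entire (F n) z) \<longlongrightarrow> eval_entire f z) net"
proof -
  have "uniform_limit {z} (\<lambda>n. eval_entire (F n)) (eval_entire f) net"
    using assms unfolding tendsto_entire_iff by (meson compact_sing)
  then show ?thesis
    by (rule tendsto_uniform_limitI) simp
qed

lemma sums_entire_iff:
  "F sums f \<longleftrightarrow>
     (\<forall>R. uniform_limit (cball 0 R) (\<lambda>n z. \<Sum>i<n. eval_entire (F i) z) (eval_entire f) sequentially)"
  unfolding sums_def tendsto_entire_cball by simp

instance entire :: topological_ab_group_add
proof
  fix f g :: entire
  have "(fst \<longlongrightarrow> f) (nhds f \<times>\<^sub>F nhds g)" "(snd \<longlongrightarrow> g) (nhds f \<times>\<^sub>F nhds g)"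
    by (rule filterlim_fst filterlim_snd)+
  then show "((\<lambda>x. fst x + snd x) \<longlongrightarrow> f + g) (nhds f \<times>\<^sub>F nhds g)"
    unfolding tendsto_entire_iff by (auto intro!: uniform_limit_intros)
  have "((\<lambda>x. x) \<longlongrightarrow> f) (nhds f)"
    by (rule filterlim_ident)
  then show "(uminus \<longlongrightarrow> - f) (nhds f)"
    unfolding tendsto_entire_iff by (auto intro!: uniform_limit_intros)
qed

lemma tendsto_scale_entire [tendsto_intros]:
  assumes "(c \<longlongrightarrow> c0) net" and "(F \<longlongrightarrow> f) net"
  shows "((\<lambda>n. scale_entire (c n) (F n)) \<longlongrightarrow> scale_entire c0 f) net"
  unfolding tendsto_entire_iff
proof (intro allI impI)
  fix K :: "complex set" assume K: "compact K"
  have "uniform_limit K (\<lambda>n z. c n) (\<lambda>z. c0) net"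
    using assms(1) unfolding tendsto_iff uniform_limit_iff by (auto elim: eventually_mono)
  moreover have "uniform_limit K (\<lambda>n. eval_entire (F n)) (eval_entire f) net"
    using assms(2) K by (simp add: tendsto_entire_iff)
  moreover have "bounded ((\<lambda>z. c0) ` K)" "bounded (eval_entire f ` K)"
    using K by (auto intro!: compact_imp_bounded compact_continuous_image)
  ultimately show "uniform_limit K (\<lambda>n. eval_entire (scale_entire (c n) (F n)))
      (eval_entire (scale_entire c0 f)) net"
    by (auto dest: uniform_lim_mult)
qed

section \<open>Neighbourhoods, closure and continuity tested on discs about the origin\<close>

lemma open_entireD:
  assumes "open U" "f \<in> U"
  obtains R e where "e > 0"
    "\<And>g. (\<And>z. norm z \<le> R \<Longrightarrow> dist (eval_entire g z) (eval_entire f z) < e) \<Longrightarrow> g \<in> U"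
proof -
  obtain K e where K: "compact K" "e > 0"
    "{g. \<forall>z\<in>K. dist (eval_entire g z) (eval_entire f z) < e} \<subseteq> U"
    using assms unfolding open_entire_def by blast
  obtain R where "K \<subseteq> cball 0 R"
    using compact_subset_cball_0[OF K(1)] by blast
  then show thesis
    using K by (intro that[of e R]) (auto simp: subset_eq)
qed

lemma open_entire_cball:
  assumes "e > 0"
  obtains U where "open U" "f \<in> U"
    "\<And>g z. g \<in> U \<Longrightarrow> norm z \<le> R \<Longrightarrow> dist (eval_entire g z) (eval_entire f z) < e"
proof -
  obtain U where "open U" "f \<in> U"
    "U \<subseteq> {g. \<forall>z\<in>cball 0 R. dist (eval_entire g z) (eval_entire f z) < e}"
    using open_entire_ball[OF compact_cball assms] by blast
  then show thesis
    by (intro that[of U]) auto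
qed

text \<open>Serves as the epsilon criterion for closure in a space without a chosen metric;
  membership in closed spans and density of orbits are checked in this form.\<close>

lemma closure_entire_iff:
  "f \<in> closure S \<longleftrightarrow>
     (\<forall>R e. e > 0 \<longrightarrow> (\<exists>g\<in>S. \<forall>z. norm z \<le> R \<longrightarrow> dist (eval_entire g z) (eval_entire f z) < e))"
proof
  assume f: "f \<in> closure S"
  show "\<forall>R e. e > 0 \<longrightarrow> (\<exists>g\<in>S. \<forall>z. norm z \<le> R \<longrightarrow> dist (eval_entire g z) (eval_entire f z) < e)"
  proof (intro allI impI)
    fix R e :: real assume "e > 0"
    then obtain U where U: "open U" "f \<in> U"
      "\<And>g z. g \<in> U \<Longrightarrow> norm z \<le> R \<Longrightarrow> dist (eval_entire g z) (eval_entire f z) < e"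
      using open_entire_cball by blast
    then obtain g where "g \<in> S" "g \<in> U"
      using f closure_iff_nhds_not_empty[of f S] by blast
    with U(3) show "\<exists>g\<in>S. \<forall>z. norm z \<le> R \<longrightarrow> dist (eval_entire g z) (eval_entire f z) < e"
      by blast
  qed
next
  assume *: "\<forall>R e. e > 0 \<longrightarrow> (\<exists>g\<in>S. \<forall>z. norm z \<le> R \<longrightarrow> dist (eval_entire g z) (eval_entire f z) < e)"
  have "S \<inter> V \<noteq> {}" if V: "open V" "f \<in> V" for V
  proof -
    obtain R e where e: "e > 0"
      and V: "\<And>g. (\<And>z. norm z \<le> R \<Longrightarrow> dist (eval_entire g z) (eval_entire f z) < e) \<Longrightarrow> g \<in> V"
      using open_entireD[OF V] by metis
    obtain g where "g \<in> S" "\<forall>z. norm z \<le> R \<longrightarrow> dist (eval_entire g z) (eval_entire f z) < e"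
      using * e by blast
    then show ?thesis using V[of g] by blast
  qed
  then show "f \<in> closure S"
    by (subst closure_iff_nhds_not_empty) blast
qed

text \<open>The numbers \<open>R'\<close> and \<open>d\<close> must not depend on the two functions.
  For a linear map this costs nothing, because the difference of the images depends only on the
  difference of the arguments.\<close>

lemma continuous_on_entireI:
  assumes "\<And>R e. e > 0 \<Longrightarrow> \<exists>R' d. d > 0 \<and> (\<forall>f g.
      (\<forall>z. norm z \<le> R' \<longrightarrow> dist (eval_entire g z) (eval_entire f z) < d) \<longrightarrow>
      (\<forall>z. norm z \<le> R \<longrightarrow> dist (eval_entire (A g) z) (eval_entire (A f) z) < e))"
  shows "continuous_on UNIV A"
proof -
  have "(A \<longlongrightarrow> A f) (at f)" for f
    unfolding tendsto_entire_cball uniform_limit_iff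
  proof (intro allI impI)
    fix R e :: real assume "e > 0"
    then obtain R' d where d: "d > 0" "\<And>g.
      (\<forall>z. norm z \<le> R' \<longrightarrow> dist (eval_entire g z) (eval_entire f z) < d) \<Longrightarrow>
      (\<forall>z. norm z \<le> R \<longrightarrow> dist (eval_entire (A g) z) (eval_entire (A f) z) < e)"
      using assms by metis
    have "((\<lambda>g. g) \<longlongrightarrow> f) (at f)"
      by (rule tendsto_ident_at)
    then have "\<forall>\<^sub>F g in at f. \<forall>z\<in>cball 0 R'. dist (eval_entire g z) (eval_entire f z) < d"
      using d(1) unfolding tendsto_entire_cball uniform_limit_iff by blast
    then show "\<forall>\<^sub>F g in at f. \<forall>z\<in>cball 0 R. dist (eval_entire (A g) z) (eval_entire (A f) z) < e"
      by eventually_elim (use d(2) in auto)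
  qed
  then show ?thesis
    by (simp add: continuous_on_def)
qed

section \<open>Continuous linear operators and closed spans\<close>

lemma linear_scale_entireI:
  assumes "\<And>f g. A (f + g) = A f + A g" "\<And>c f. A (scale_entire c f) = scale_entire c (A f)"
  shows "Vector_Spaces.linear scale_entire scale_entire A"
  by (simp add: Vector_Spaces.linear_iff vector_space_entire assms)

lemma continuous_linear_operatorD:
  assumes "continuous_linear_operator scale_entire A"
  shows "A 0 = 0" "A (f + g) = A f + A g" "A (scale_entire c f) = scale_entire c (A f)"
    "continuous_on UNIV A" "(F \<longlongrightarrow> f) net \<Longrightarrow> ((\<lambda>n. A (F n)) \<longlongrightarrow> A f) net"
    "G sums f \<Longrightarrow> (\<lambda>n. A (G n)) sums A f"
proof -
  interpret A: Vector_Spaces.linear scale_entire scale_entire A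
    using assms by (simp add: continuous_linear_operator_def)
  show "A 0 = 0" "A (f + g) = A f + A g" "A (scale_entire c f) = scale_entire c (A f)"
    by (simp_all add: A.zero A.add A.scale)
  show cont: "continuous_on UNIV A"
    using assms by (simp add: continuous_linear_operator_def)
  show "(F \<longlongrightarrow> f) net \<Longrightarrow> ((\<lambda>n. A (F n)) \<longlongrightarrow> A f) net"
    using continuous_on_tendsto_compose[OF cont] by simp
  show "G sums f \<Longrightarrow> (\<lambda>n. A (G n)) sums A f"
    using continuous_on_tendsto_compose[OF cont] unfolding sums_def by (force simp: A.sum)
qed

lemma continuous_linear_operator_scale: "continuous_linear_operator scale_entire (scale_entire c)"
  unfolding continuous_linear_operator_def
  by (auto intro!: linear_scale_entireI tendsto_scale_entire
      simp: continuous_on_def entire.scale_right_distrib entire.scale_left_commute)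

lemma subspace_closure_entire:
  assumes "entire.subspace S"
  shows "entire.subspace (closure S)"
  unfolding entire.subspace_def
proof (intro conjI ballI allI)
  show "0 \<in> closure S"
    using assms entire.subspace_0 closure_subset by blast
  fix f g assume fg: "f \<in> closure S" "g \<in> closure S"
  show "f + g \<in> closure S"
    unfolding closure_entire_iff
  proof (intro allI impI)
    fix R e :: real assume "e > 0"
    then have "e / 2 > 0" by simp
    with fg obtain f' g' where f': "f' \<in> S" "\<And>z. norm z \<le> R \<Longrightarrow> dist (eval_entire f' z) (eval_entire f z) < e / 2"
      and g': "g' \<in> S" "\<And>z. norm z \<le> R \<Longrightarrow> dist (eval_entire g' z) (eval_entire g z) < e / 2"
      unfolding closure_entire_iff by metis
    then show "\<exists>h\<in>S. \<forall>z. norm z \<le> R \<longrightarrow> dist (eval_entire h z) (eval_entire (f + g) z) < e"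
      using entire.subspace_add[OF assms f'(1) g'(1)]
      by (intro bexI[of _ "f' + g'"]) (auto intro!: dist_triangle_add_half)
  qed
next
  fix c f assume f: "f \<in> closure S"
  have "scale_entire c ` closure S \<subseteq> closure S"
  proof (rule image_closure_subset)
    show "continuous_on (closure S) (scale_entire c)"
      using continuous_linear_operator_scale[of c]
      by (auto simp: continuous_linear_operator_def intro: continuous_on_subset)
    show "scale_entire c ` S \<subseteq> closure S"
      using entire.subspace_scale[OF assms] closure_subset[of S] by blast
  qed simp
  then show "scale_entire c f \<in> closure S"
    using f by blast
qed

lemma closed_subspace_sums:
  assumes "closed M" "entire.subspace M" "\<And>n. F n \<in> M" "F sums f"
  shows "f \<in> M"
proof (rule Lim_in_closed_set)
  show "\<forall>\<^sub>F n in sequentially. (\<Sum>i<n. F i) \<in> M"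
    using assms(2,3) by (simp add: entire.subspace_sum)
qed (use assms in \<open>auto simp: sums_def\<close>)

lemma closed_span_least:
  assumes "closed M" "entire.subspace M" "B \<subseteq> M"
  shows "closure (entire.span B) \<subseteq> M"
  using assms by (intro closure_minimal entire.span_minimal) auto

text \<open>With this, inclusions of closed spans need only be checked on generators.\<close>

lemma closed_subspace_vimage:
  assumes A: "continuous_linear_operator scale_entire A" and "closed M" "entire.subspace M"
  shows "closed (A -` M)" "entire.subspace (A -` M)"
  using continuous_linear_operatorD(1-4)[OF A] assms(2,3)
  by (auto simp: closed_vimage continuous_on_closed_vimage entire.subspace_def)

lemma closed_subspace_closed_span:
  "closed (closure (entire.span B))" "entire.subspace (closure (entire.span B))"
  by (auto intro: subspace_closure_entire)

lemma closed_span_superset: "B \<subseteq> closure (entire.span B)"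
  using entire.span_superset closure_subset by blast

section \<open>Translation, multiplication and Taylor expansion\<close>

lift_definition translate_entire :: "complex \<Rightarrow> entire \<Rightarrow> entire" is "\<lambda>c f z. f (z + c)"
  by (rule holomorphic_on_compose_gen[unfolded o_def, where t = UNIV])
     (auto intro!: holomorphic_intros)

lift_definition mult_entire :: "entire \<Rightarrow> entire \<Rightarrow> entire" is "\<lambda>f g z. f z * g z"
  by (rule holomorphic_on_mult)

lift_definition poly_entire :: "complex poly \<Rightarrow> entire" is poly
  by (intro holomorphic_intros)

lemma eval_entire_ops [simp]:
  "eval_entire (translate_entire c f) = (\<lambda>z. eval_entire f (z + c))"
  "eval_entire (mult_entire f g) = (\<lambda>z. eval_entire f z * eval_entire g z)"
  "eval_entire (poly_entire p) = poly p"
  by (transfer, simp)+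

section \<open>Differentiation, translation and multiplication as continuous operators\<close>

lemma field_differentiable_eval_entire [simp]: "eval_entire f field_differentiable at z"
  by (rule holomorphic_on_imp_differentiable_at[OF holomorphic_eval_entire open_UNIV UNIV_I])

lemma DERIV_eval_entire: "(eval_entire f has_field_derivative deriv (eval_entire f) z) (at z)"
  by (simp add: DERIV_deriv_iff_field_differentiable)

lemma deriv_entire_add: "deriv_entire (f + g) = deriv_entire f + deriv_entire g"
  by (rule entire_eqI) simp

lemma deriv_entire_scale: "deriv_entire (scale_entire c f) = scale_entire c (deriv_entire f)"
  by (rule entire_eqI) simp

lemma deriv_entire_translate:
  "deriv_entire (translate_entire c f) = translate_entire c (deriv_entire f)"
proof (rule entire_eqI)
  fix z
  have "((\<lambda>z. eval_entire f (z + c)) has_field_derivative deriv (eval_entire f) (z + c)) (at z)"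
    using DERIV_eval_entire[of f "z + c"] by (simp add: DERIV_shift)
  then show "eval_entire (deriv_entire (translate_entire c f)) z =
      eval_entire (translate_entire c (deriv_entire f)) z"
    by (simp add: DERIV_imp_deriv)
qed

lemma funpow_deriv_entire_translate:
  "(deriv_entire ^^ n) (translate_entire c f) = translate_entire c ((deriv_entire ^^ n) f)"
  by (induction n) (auto simp: deriv_entire_translate)

lemma funpow_deriv_entire_poly: "(deriv_entire ^^ n) (poly_entire p) = poly_entire ((pderiv ^^ n) p)"
proof (induction n)
  case (Suc n)
  have "deriv_entire (poly_entire q) = poly_entire (pderiv q)" for q
    by (rule entire_eqI) (auto intro!: DERIV_imp_deriv poly_DERIV)
  with Suc show ?case by simp
qed simp

lemma deriv_entire_mult_X:
  "deriv_entire (mult_entire (poly_entire [:0, 1:]) f) =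
     f + mult_entire (poly_entire [:0, 1:]) (deriv_entire f)"
proof (rule entire_eqI)
  fix z
  have "((\<lambda>z. z * eval_entire f z) has_field_derivative
      eval_entire f z + z * deriv (eval_entire f) z) (at z)"
    by (auto intro!: derivative_eq_intros DERIV_eval_entire)
  then show "eval_entire (deriv_entire (mult_entire (poly_entire [:0, 1:]) f)) z =
      eval_entire (f + mult_entire (poly_entire [:0, 1:]) (deriv_entire f)) z"
    by (simp add: DERIV_imp_deriv)
qed

text \<open>Cauchy's inequality on the circle of radius \<open>r\<close> about \<open>z\<close>. The
  bound is taken on a disc about the origin, so that a single \<open>B\<close> can serve all points
  \<open>z\<close> of a smaller disc.\<close>

lemma norm_higher_deriv_entire_le:
  assumes "\<And>w. norm w \<le> norm z + r \<Longrightarrow> norm (eval_entire f w) \<le> B" and "r > 0"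
  shows "norm ((deriv ^^ n) (eval_entire f) z) \<le> fact n * B / r ^ n"
proof (rule Cauchy_inequality)
  fix w assume "norm (z - w) = r"
  then have "norm w \<le> norm z + r"
    using norm_triangle_sub[of w z] by (simp add: norm_minus_commute)
  then show "norm (eval_entire f w) \<le> B"
    by (rule assms(1))
qed (use assms in auto)

lemma continuous_linear_operator_deriv: "continuous_linear_operator scale_entire deriv_entire"
  unfolding continuous_linear_operator_def
proof
  show "Vector_Spaces.linear scale_entire scale_entire deriv_entire"
    by (rule linear_scale_entireI) (auto simp: deriv_entire_add deriv_entire_scale)
  show "continuous_on UNIV deriv_entire"
  proof (rule continuous_on_entireI, intro exI conjI allI impI)
    fix R e :: real and f g :: entire and z :: complex
    assume e: "e > 0" and z: "norm z \<le> R"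
      and fg: "\<forall>z. norm z \<le> R + 1 \<longrightarrow> dist (eval_entire g z) (eval_entire f z) < e / 2"
    have eq: "deriv_entire g - deriv_entire f = deriv_entire (g - f)"
      using deriv_entire_add[of "g - f" f] by simp
    have "norm ((deriv ^^ 1) (eval_entire (g - f)) z) \<le> fact 1 * (e / 2) / 1 ^ 1"
      using fg z by (intro norm_higher_deriv_entire_le) (auto simp: dist_norm less_imp_le)
    then have "norm (eval_entire (deriv_entire (g - f)) z) \<le> e / 2"
      by simp
    then show "dist (eval_entire (deriv_entire g) z) (eval_entire (deriv_entire f) z) < e"
      using e unfolding eq[symmetric] by (simp add: dist_norm)
  next
    show "e / 2 > 0" if "e > 0" for e :: real
      using that by simp
  qed
qed

lemma continuous_linear_operator_translate:
  "continuous_linear_operator scale_entire (translate_entire c)"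
  unfolding continuous_linear_operator_def
proof
  show "Vector_Spaces.linear scale_entire scale_entire (translate_entire c)"
    by (rule linear_scale_entireI) (auto intro: entire_eqI)
  show "continuous_on UNIV (translate_entire c)"
  proof (rule continuous_on_entireI, intro exI conjI allI impI)
    fix R e :: real and f g :: entire and z :: complex
    assume e: "e > 0" and z: "norm z \<le> R"
      and "\<forall>z. norm z \<le> R + norm c \<longrightarrow> dist (eval_entire g z) (eval_entire f z) < e"
    then show "dist (eval_entire (translate_entire c g) z) (eval_entire (translate_entire c f) z) < e"
      using norm_triangle_ineq[of z c] by simp
  qed
qed

lemma continuous_linear_operator_mult: "continuous_linear_operator scale_entire (mult_entire h)"
  unfolding continuous_linear_operator_def
proof
  show "Vector_Spaces.linear scale_entire scale_entire (mult_entire h)"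
    by (rule linear_scale_entireI) (auto intro: entire_eqI simp: algebra_simps)
  show "continuous_on UNIV (mult_entire h)"
  proof (rule continuous_on_entireI)
    fix R e :: real assume e: "e > 0"
    obtain B where B: "B > 0" "\<And>z. norm z \<le> R \<Longrightarrow> norm (eval_entire h z) \<le> B"
      using eval_entire_bound by blast
    have "dist (eval_entire (mult_entire h g) z) (eval_entire (mult_entire h f) z) < e"
      if "\<forall>z. norm z \<le> R \<longrightarrow> dist (eval_entire g z) (eval_entire f z) < e / B" "norm z \<le> R" for f g z
    proof -
      have "dist (eval_entire (mult_entire h g) z) (eval_entire (mult_entire h f) z) =
          norm (eval_entire h z) * dist (eval_entire g z) (eval_entire f z)"
        by (simp add: dist_norm norm_mult flip: right_diff_distrib)
      also have "\<dots> \<le> B * dist (eval_entire g z) (eval_entire f z)"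
        using that(2) B(2) by (intro mult_right_mono) auto
      also have "\<dots> < B * (e / B)"
        using that B(1) by (intro mult_strict_left_mono) auto
      finally show ?thesis using B(1) by simp
    qed
    then show "\<exists>R' d. d > 0 \<and> (\<forall>f g.
        (\<forall>z. norm z \<le> R' \<longrightarrow> dist (eval_entire g z) (eval_entire f z) < d) \<longrightarrow>
        (\<forall>z. norm z \<le> R \<longrightarrow> dist (eval_entire (mult_entire h g) z) (eval_entire (mult_entire h f) z) < e))"
      using e B(1) by (intro exI[of _ R] exI[of _ "e / B"]) auto
  qed
qed

text \<open>Stated for functions on a disc and not only for entire ones, because it is also applied
  to the reciprocal of an entire function that has no zeros in that disc.\<close>

lemma uniform_limit_Taylor_0:
  fixes f :: "complex \<Rightarrow> complex"
  assumes "f holomorphic_on ball 0 r" "s < r"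
  shows "uniform_limit (cball 0 s) (\<lambda>n z. \<Sum>i<n. (deriv ^^ i) f 0 / fact i * z ^ i) f sequentially"
proof -
  define c where "c = (\<lambda>i. (deriv ^^ i) f 0 / fact i)"
  have "ereal r \<le> fps_conv_radius (fps_expansion f 0)"
    using assms(1) by (intro conv_radius_fps_expansion) auto
  then have "ereal s < conv_radius c"
    using assms(2) less_le_trans[of "ereal s" "ereal r"]
    by (simp add: fps_conv_radius_def fps_expansion_def c_def)
  then have "uniform_limit (cball 0 s) (\<lambda>n z. \<Sum>i<n. c i * (z - 0) ^ i)
      (\<lambda>z. \<Sum>i. c i * (z - 0) ^ i) sequentially"
    by (rule powser_uniform_limit)
  moreover have "(\<Sum>i. c i * (z - 0) ^ i) = f z" if "z \<in> cball 0 s" for z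
    using holomorphic_power_series[OF assms(1), of z] that assms(2)
    by (auto simp: c_def sums_iff)
  ultimately show ?thesis
    unfolding c_def by (subst (asm) uniform_limit_cong') auto
qed

text \<open>Convergence takes place in H(C), so a continuous operator may be applied term by term.
  The dependence on \<open>w\<close> sits in the scalar coefficients, and the operator sees only
  monomials.\<close>

lemma Taylor_sums_entire:
  "(\<lambda>n. scale_entire ((deriv ^^ n) (eval_entire f) w / fact n) (poly_entire (monom 1 n)))
     sums translate_entire w f"
  unfolding sums_entire_iff
proof
  fix R
  have "(deriv ^^ n) (eval_entire (translate_entire w f)) 0 = (deriv ^^ n) (eval_entire f) w" for n
    using funpow_deriv_entire_translate[of n w f]
    by (metis add_0 eval_entire_funpow_deriv eval_entire_ops(1))
  then show "uniform_limit (cball 0 R) (\<lambda>n z. \<Sum>i<n. eval_entire (scale_entire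
      ((deriv ^^ i) (eval_entire f) w / fact i) (poly_entire (monom 1 i))) z)
      (eval_entire (translate_entire w f)) sequentially"
    using uniform_limit_Taylor_0[of "eval_entire (translate_entire w f)" "R + 1" R]
      holomorphic_eval_entire[of "translate_entire w f" "ball 0 (R + 1)"]
    by (simp add: poly_monom del: holomorphic_eval_entire)
qed

lemma Taylor_sums_eval_entire:
  "(\<lambda>n. (deriv ^^ n) (eval_entire f) w / fact n * z ^ n) sums eval_entire f (w + z)"
  using tendsto_eval_entire[OF Taylor_sums_entire[of f w, unfolded sums_def], of z]
  by (simp add: sums_def poly_monom add.commute)

text \<open>Cauchy's inequality with radius \<open>2 * S\<close> gives |f^(n)(z)| / n! \<le> B / (2
  S)^n, so the terms are dominated by B C / 2^n and the Weierstrass test upgrades pointwise to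
  uniform convergence on discs. The choice \<psi> n = c^n yields translations; the values at 0 of an
  operator on monomials yield multiplication by z.\<close>

lemma derivs_sums_entire:
  assumes \<psi>: "\<And>n. norm (\<psi> n) \<le> C * S ^ n" and S: "S > 0"
    and g: "\<And>z. (\<lambda>n. (deriv ^^ n) (eval_entire f) z / fact n * \<psi> n) sums eval_entire g z"
  shows "(\<lambda>n. scale_entire (\<psi> n / fact n) ((deriv_entire ^^ n) f)) sums g"
  unfolding sums_entire_iff
proof
  fix R :: real
  obtain B where B: "B > 0" "\<And>z. norm z \<le> R + 2 * S \<Longrightarrow> norm (eval_entire f z) \<le> B"
    using eval_entire_bound by blast
  let ?F = "\<lambda>n z. (deriv ^^ n) (eval_entire f) z / fact n * \<psi> n"
  have "norm (?F n z) \<le> B * C * (1 / 2) ^ n" if "z \<in> cball 0 R" for n z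
  proof -
    have "norm ((deriv ^^ n) (eval_entire f) z) \<le> fact n * B / (2 * S) ^ n"
      using that S by (intro norm_higher_deriv_entire_le B(2)) auto
    then have "norm ((deriv ^^ n) (eval_entire f) z / fact n) \<le> B / (2 * S) ^ n"
      by (simp add: norm_divide field_simps)
    then have "norm (?F n z) \<le> B / (2 * S) ^ n * (C * S ^ n)"
      unfolding norm_mult using \<psi> by (intro mult_mono) (use B S in auto)
    then show ?thesis
      using S by (simp add: power_mult_distrib field_simps)
  qed
  then have "uniform_limit (cball 0 R) (\<lambda>n z. \<Sum>i<n. ?F i z) (\<lambda>z. \<Sum>i. ?F i z) sequentially"
    by (rule Weierstrass_m_test) (auto intro!: summable_mult summable_geometric)
  moreover have "(\<lambda>z. \<Sum>i. ?F i z) = eval_entire g"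
    by (rule ext) (rule sums_unique[OF g, symmetric])
  ultimately show "uniform_limit (cball 0 R) (\<lambda>n z. \<Sum>i<n. eval_entire
      (scale_entire (\<psi> i / fact i) ((deriv_entire ^^ i) f)) z) (eval_entire g) sequentially"
    by (simp add: mult.commute)
qed

lemma translate_sums_derivs:
  "(\<lambda>n. scale_entire (c ^ n / fact n) ((deriv_entire ^^ n) f)) sums translate_entire c f"
proof (rule derivs_sums_entire)
  \<comment> \<open>The base is \<open>norm c + 1\<close> and not \<open>norm c\<close>, since it
    has to be positive also for c = 0.\<close>
  show "norm (c ^ n) \<le> 1 * (norm c + 1) ^ n" for n
    by (simp add: norm_power power_mono)
  show "norm c + 1 > 0"
    by (rule add_nonneg_pos) auto
qed (use Taylor_sums_eval_entire in simp)

lemma translate_entire_0 [simp]: "translate_entire 0 f = f"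
  by (rule entire_eqI) simp

section \<open>Closed ideals invariant under differentiation\<close>

text \<open>Induction on the number of distinct zeros in the disc. A zero is divided out with its
  full multiplicity, so it is no longer a zero of the quotient and the count drops.\<close>

lemma entire_eq_poly_times_nonvanishing:
  assumes "f \<noteq> 0"
  obtains p g where "p \<noteq> 0" "f = mult_entire (poly_entire p) g"
    "\<And>z. norm z \<le> R \<Longrightarrow> eval_entire g z \<noteq> 0"
proof -
  let ?Z = "\<lambda>f. {z \<in> cball 0 R. eval_entire f z = 0}"
  have "\<exists>p g. p \<noteq> 0 \<and> f = mult_entire (poly_entire p) g \<and> ?Z g = {}"
    using assms
  proof (induction "card (?Z f)" arbitrary: f rule: less_induct)
    case less
    show ?case
    proof (cases "?Z f = {}")
      case True
      then show ?thesis
        by (intro exI[of _ 1] exI[of _ f]) (auto intro: entire_eqI)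
    next
      case False
      then obtain \<xi> where \<xi>: "\<xi> \<in> cball 0 R" "eval_entire f \<xi> = 0"
        by auto
      have nc: "\<not> eval_entire f constant_on UNIV"
      proof
        assume "eval_entire f constant_on UNIV"
        then have "eval_entire f z = 0" for z
          using \<xi>(2) unfolding constant_on_def by (metis UNIV_I)
        then show False
          using less.prems by (auto intro: entire_eqI)
      qed
      \<comment> \<open>Zeros of a nonconstant entire function are isolated. Finiteness matters
        because \<open>card\<close> is 0 on infinite sets and would not measure the descent.\<close>
      have fin: "finite (?Z f)"
        by (rule holomorphic_compact_finite_zeros[OF holomorphic_eval_entire open_UNIV connected_UNIV])
           (use nc in auto)
      obtain h r n where h: "0 < n" "0 < r" "h holomorphic_on ball \<xi> r"
        "\<And>w. w \<in> ball \<xi> r \<Longrightarrow> eval_entire f w = (w - \<xi>) ^ n * h w"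
        "\<And>w. w \<in> ball \<xi> r \<Longrightarrow> h w \<noteq> 0"
        using holomorphic_factor_zero_nonconstant[OF holomorphic_eval_entire open_UNIV connected_UNIV
            UNIV_I \<xi>(2) nc] by metis
      \<comment> \<open>The quotient, with its removable singularity filled by the value of the
        local factor \<open>h\<close>. Holomorphy is glued from the disc about \<xi> and the
        punctured plane.\<close>
      define k where "k = (\<lambda>z. if z = \<xi> then h \<xi> else eval_entire f z / (z - \<xi>) ^ n)"
      have "k holomorphic_on ball \<xi> r"
        by (rule holomorphic_transform[OF h(3)]) (use h in \<open>auto simp: k_def\<close>)
      moreover have "k holomorphic_on - {\<xi>}"
        by (rule holomorphic_transform[where f = "\<lambda>z. eval_entire f z / (z - \<xi>) ^ n"])
           (auto simp: k_def intro!: holomorphic_intros)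
      ultimately have "k holomorphic_on ball \<xi> r \<union> - {\<xi>}"
        by (rule holomorphic_on_Un) auto
      moreover have "ball \<xi> r \<union> - {\<xi>} = UNIV"
        using h(2) by auto
      ultimately have k: "eval_entire (Entire k) = k"
        by (simp add: Entire_inverse)
      have f_eq: "f = mult_entire (poly_entire ([:- \<xi>, 1:] ^ n)) (Entire k)"
      proof (rule entire_eqI)
        fix z
        have "eval_entire f z = (z - \<xi>) ^ n * k z"
          using h(1) \<xi>(2) by (simp add: k_def)
        then show "eval_entire f z = eval_entire (mult_entire (poly_entire ([:- \<xi>, 1:] ^ n)) (Entire k)) z"
          by (simp add: k)
      qed
      have "?Z (Entire k) \<subset> ?Z f"
      proof
        show "?Z (Entire k) \<subseteq> ?Z f"
          using f_eq by (metis (mono_tags, lifting) Collect_mono eval_entire_ops(2) mult_zero_right)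
        have "k \<xi> \<noteq> 0"
          using h(2,5) by (simp add: k_def)
        then have "\<xi> \<in> ?Z f - ?Z (Entire k)"
          using \<xi> by (simp add: k)
        then show "?Z (Entire k) \<noteq> ?Z f"
          by blast
      qed
      then have "card (?Z (Entire k)) < card (?Z f)"
        using fin by (rule psubset_card_mono[rotated])
      moreover have "Entire k \<noteq> 0"
        using f_eq less.prems by (metis entire_eqI eval_entire_ops(2) eval_entire_simps(1) mult_zero_right)
      ultimately obtain p g where pg: "p \<noteq> 0" "Entire k = mult_entire (poly_entire p) g" "?Z g = {}"
        using less.hyps by blast
      show ?thesis
      proof (intro exI conjI)
        show "f = mult_entire (poly_entire ([:- \<xi>, 1:] ^ n * p)) g"
          unfolding f_eq pg(2) by (rule entire_eqI) simp
      qed (use pg in auto)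
    qed
  qed
  then show thesis
    using that by fastforce
qed

lemma funpow_pderiv_degree:
  fixes p :: "complex poly"
  shows "(pderiv ^^ degree p) p = [:fact (degree p) * lead_coeff p:]"
proof (rule poly_eqI)
  fix n
  show "coeff ((pderiv ^^ degree p) p) n = coeff [:fact (degree p) * lead_coeff p:] n"
    by (cases n) (auto simp: coeff_higher_pderiv pochhammer_fact coeff_eq_0)
qed

text \<open>Multiplication by z and closedness give multiplication by every entire function, through
  its Taylor series at 0. It then suffices that the constant 1 lies in \<open>M\<close>, and this is
  verified disc by disc, with an approximating element that depends on the disc.\<close>

lemma closed_ideal_deriv_invariant_eq_UNIV:
  assumes cl: "closed M" and sub: "entire.subspace M"
    and f: "f \<in> M" "f \<noteq> 0"
    and D: "\<And>g. g \<in> M \<Longrightarrow> deriv_entire g \<in> M"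
    and X: "\<And>g. g \<in> M \<Longrightarrow> mult_entire (poly_entire [:0, 1:]) g \<in> M"
  shows "M = UNIV"
proof -
  have Dn: "(deriv_entire ^^ n) g \<in> M" if "g \<in> M" for n g
    using that D by (induction n) auto
  have Xn: "mult_entire (poly_entire (monom 1 n)) g \<in> M" if "g \<in> M" for n g
  proof (induction n)
    case 0
    have "mult_entire (poly_entire (monom 1 0)) g = g"
      by (rule entire_eqI) (simp add: poly_monom)
    with that show ?case by simp
  next
    case (Suc n)
    have "mult_entire (poly_entire (monom 1 (Suc n))) g =
        mult_entire (poly_entire [:0, 1:]) (mult_entire (poly_entire (monom 1 n)) g)"
      by (rule entire_eqI) (simp add: poly_monom)
    with X[OF Suc] show ?case by simp
  qed
  have ideal: "mult_entire h g \<in> M" if "g \<in> M" for h g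
  proof (rule closed_subspace_sums[OF cl sub])
    let ?c = "\<lambda>n. (deriv ^^ n) (eval_entire h) 0 / fact n"
    have "(\<lambda>n. mult_entire g (scale_entire (?c n) (poly_entire (monom 1 n)))) sums mult_entire g h"
      using Taylor_sums_entire[of h 0]
      by (intro continuous_linear_operatorD(6)[OF continuous_linear_operator_mult]) simp
    moreover have "mult_entire g h = mult_entire h g"
      by (rule entire_eqI) simp
    moreover have "mult_entire g (scale_entire (?c n) (poly_entire (monom 1 n))) =
        scale_entire (?c n) (mult_entire (poly_entire (monom 1 n)) g)" for n
      by (rule entire_eqI) simp
    ultimately show "(\<lambda>n. scale_entire (?c n) (mult_entire (poly_entire (monom 1 n)) g)) sums mult_entire h g"
      by simp
    show "scale_entire (?c n) (mult_entire (poly_entire (monom 1 n)) g) \<in> M" for n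
      using Xn[OF that] sub by (rule entire.subspace_scale[rotated])
  qed
  have "poly_entire 1 \<in> closure M"
    unfolding closure_entire_iff
  proof (intro allI impI)
    fix R e :: real assume e: "e > 0"
    \<comment> \<open>Two units of radius are spent: 1/g is holomorphic on the open disc of radius
      \<open>R + 2\<close>, its Taylor polynomials converge uniformly on the disc of radius
      \<open>R + 1\<close>, and Cauchy's inequality with radius 1 leads down to
      \<open>R\<close>.\<close>
    obtain p g where pg: "p \<noteq> 0" "f = mult_entire (poly_entire p) g"
      "\<And>z. norm z \<le> R + 2 \<Longrightarrow> eval_entire g z \<noteq> 0"
      using entire_eq_poly_times_nonvanishing[OF f(2)] by blast
    \<comment> \<open>The constant value of the derivative of order \<open>degree p\<close> of p.
      Dividing by it normalises the approximated constant to 1.\<close>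
    define C where "C = fact (degree p) * lead_coeff p"
    have C: "C \<noteq> 0"
      using pg(1) by (simp add: C_def)
    obtain B where B: "B > 0" "\<And>z. norm z \<le> R + 1 \<Longrightarrow> norm (eval_entire f z) \<le> B"
      using eval_entire_bound by blast
    \<comment> \<open>With |q f - p| \<le> \<open>d * B\<close>, Cauchy's inequality bounds the
      derivative of order \<open>degree p\<close> of this error by |C| e / 2.\<close>
    define d where "d = e / 2 * norm C / (fact (degree p) * B)"
    have d: "d > 0"
      using e C B(1) by (simp add: d_def)
    let ?g = "\<lambda>z. 1 / eval_entire g z"
    have "?g holomorphic_on ball 0 (R + 2)"
      using pg(3) by (auto intro!: holomorphic_intros)
    then have "uniform_limit (cball 0 (R + 1)) (\<lambda>n z. \<Sum>i<n. (deriv ^^ i) ?g 0 / fact i * z ^ i) ?g sequentially"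
      by (rule uniform_limit_Taylor_0) simp
    then have "\<forall>\<^sub>F n in sequentially. \<forall>z\<in>cball 0 (R + 1).
        dist (\<Sum>i<n. (deriv ^^ i) ?g 0 / fact i * z ^ i) (?g z) < d"
      using d unfolding uniform_limit_iff by blast
    then obtain n where n: "\<And>z. norm z \<le> R + 1 \<Longrightarrow>
        dist (\<Sum>i<n. (deriv ^^ i) ?g 0 / fact i * z ^ i) (?g z) < d"
      using eventually_happens'[OF sequentially_bot] by fastforce
    define q where "q = (\<Sum>i<n. monom ((deriv ^^ i) ?g 0 / fact i) i)"
    have q: "norm (poly q z - 1 / eval_entire g z) < d" if "norm z \<le> R + 1" for z
      using n[OF that] by (simp add: q_def poly_sum poly_monom dist_norm)
    define h where "h = scale_entire (1 / C) ((deriv_entire ^^ degree p) (mult_entire (poly_entire q) f))"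
    have "h \<in> M"
      unfolding h_def using Dn[OF ideal[OF f(1)]] by (rule entire.subspace_scale[OF sub])
    moreover have "dist (eval_entire h z) (eval_entire (poly_entire 1) z) < e" if z: "norm z \<le> R" for z
    proof -
      define u where "u = mult_entire (poly_entire q) f - poly_entire p"
      have u: "norm (eval_entire u w) \<le> d * B" if "norm w \<le> norm z + 1" for w
      proof -
        have w: "norm w \<le> R + 1" using that z by simp
        have "eval_entire u w = (poly q w - 1 / eval_entire g w) * eval_entire f w"
          using pg(3)[of w] w by (simp add: u_def pg(2) field_simps)
        then show ?thesis
          using q[OF w] B(2)[OF w] d by (simp add: norm_mult mult_mono)
      qed
      have "norm ((deriv ^^ degree p) (eval_entire u) z) \<le> fact (degree p) * (d * B) / 1 ^ degree p"
        by (rule norm_higher_deriv_entire_le) (use u in auto)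
      also have "\<dots> = e / 2 * norm C"
        using B(1) by (simp add: d_def field_simps)
      finally have bound: "norm ((deriv ^^ degree p) (eval_entire u) z) \<le> e / 2 * norm C" .
      have diff: "(deriv_entire ^^ k) (v - w) = (deriv_entire ^^ k) v - (deriv_entire ^^ k) w" for k v w
      proof (induction k)
        case (Suc k)
        have "deriv_entire (v - w) = deriv_entire v - deriv_entire w" for v w
          using deriv_entire_add[of "v - w" w] by simp
        with Suc show ?case by simp
      qed simp
      have "(deriv_entire ^^ degree p) u =
          (deriv_entire ^^ degree p) (mult_entire (poly_entire q) f) - poly_entire [:C:]"
        unfolding u_def diff funpow_deriv_entire_poly funpow_pderiv_degree C_def ..
      moreover have "scale_entire (1 / C) (poly_entire [:C:]) = poly_entire 1"
        using C by (intro entire_eqI) simp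
      ultimately have "scale_entire (1 / C) ((deriv_entire ^^ degree p) u) = h - poly_entire 1"
        by (simp only: h_def entire.scale_right_diff_distrib)
      then have "eval_entire (scale_entire (1 / C) ((deriv_entire ^^ degree p) u)) z = eval_entire (h - poly_entire 1) z"
        by (rule arg_cong)
      then have "eval_entire h z - eval_entire (poly_entire 1) z = (deriv ^^ degree p) (eval_entire u) z / C"
        by simp
      then have "dist (eval_entire h z) (eval_entire (poly_entire 1) z) =
          norm ((deriv ^^ degree p) (eval_entire u) z) / norm C"
        by (simp only: dist_norm norm_divide)
      also have "\<dots> \<le> e / 2"
        using bound C by (simp add: field_simps)
      finally show ?thesis using e by simp
    qed
    ultimately show "\<exists>h\<in>M. \<forall>z. norm z \<le> R \<longrightarrow> dist (eval_entire h z) (eval_entire (poly_entire 1) z) < e"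
      by blast
  qed
  then have "poly_entire 1 \<in> M"
    using cl by simp
  moreover have "mult_entire h (poly_entire 1) = h" for h
    by (rule entire_eqI) simp
  ultimately show ?thesis
    using ideal by (metis UNIV_eq_I)
qed

section \<open>Translates of a kernel element\<close>

text \<open>A derivative is the limit in H(C) of difference quotients, and these stay in the closed
  span because c + h lies in the open set \<open>U\<close> for small h. The induction on
  \<open>n\<close> needs all \<open>c\<close> in \<open>U\<close> at once, as the quotient involves
  neighbouring translates.\<close>

lemma translate_in_closed_span_translates:
  assumes U: "open U" "c \<in> U"
  shows "translate_entire c ((deriv_entire ^^ n) f)
    \<in> closure (entire.span ((\<lambda>c. translate_entire c f) ` U))" (is "_ \<in> ?N")
  using U(2)
proof (induction n arbitrary: c)
  case 0
  then show ?case
    using closed_span_superset by fastforce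
next
  case (Suc n)
  define g where "g = (deriv_entire ^^ n) f"
  define Q where "Q = (\<lambda>h. scale_entire (1 / h) (translate_entire (c + h) g - translate_entire c g))"
  have lim: "(Q \<longlongrightarrow> translate_entire c (deriv_entire g)) (at 0)"
    unfolding tendsto_entire_cball
  proof
    fix R
    \<comment> \<open>A bound for the second derivative on a slightly larger disc: the Taylor
      remainder then makes the error of the difference quotient at most B |h|, uniformly on the disc
      of radius \<open>R\<close>.\<close>
    obtain B where B: "B > 0" "\<And>z. norm z \<le> norm c + R + 1 \<Longrightarrow>
        norm (eval_entire ((deriv_entire ^^ 2) g) z) \<le> B"
      using eval_entire_bound by blast
    have bound: "dist (eval_entire (Q h) z) (eval_entire (translate_entire c (deriv_entire g)) z) \<le> B * norm h"
      if h: "h \<noteq> 0" "norm h < 1" and z: "norm z \<le> R" for h z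
    proof -
      have *: "norm (z + c) \<le> norm c + R" using z norm_triangle_ineq[of z c] by simp
      have "norm ((deriv ^^ 0) (eval_entire g) (z + c + h) -
          (\<Sum>i\<le>1. (deriv ^^ i) (eval_entire g) (z + c) * (z + c + h - (z + c)) ^ i / fact i))
        \<le> B * norm (z + c + h - (z + c)) ^ Suc 1 / fact 1"
      proof (rule complex_Taylor[where S = "cball 0 (norm c + R + 1)"])
        show "((deriv ^^ i) (eval_entire g) has_field_derivative (deriv ^^ Suc i) (eval_entire g) x)
            (at x within cball 0 (norm c + R + 1))" for i x
          using DERIV_eval_entire[of "(deriv_entire ^^ i) g" x]
          by (auto intro: has_field_derivative_at_within)
        show "norm ((deriv ^^ Suc 1) (eval_entire g) x) \<le> B" if "x \<in> cball 0 (norm c + R + 1)" for x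
          using B(2)[of x] that by (simp add: numeral_2_eq_2)
        show "z + c + h \<in> cball 0 (norm c + R + 1)"
          using * h(2) norm_triangle_ineq[of "z + c" h] by simp
      qed (use * in auto)
      then have "norm (eval_entire g (z + c + h) - eval_entire g (z + c) - deriv (eval_entire g) (z + c) * h)
          \<le> B * norm h ^ 2"
        by (simp add: power2_eq_square algebra_simps)
      moreover have "eval_entire (Q h) z - eval_entire (translate_entire c (deriv_entire g)) z =
          (eval_entire g (z + c + h) - eval_entire g (z + c) - deriv (eval_entire g) (z + c) * h) / h"
        using h(1) by (simp add: Q_def field_simps)
      ultimately have "dist (eval_entire (Q h) z) (eval_entire (translate_entire c (deriv_entire g)) z)
          \<le> B * norm h ^ 2 / norm h"
        unfolding dist_norm norm_divide by (simp only: divide_right_mono norm_ge_zero norm_divide)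
      then show ?thesis
        using h(1) by (simp add: power2_eq_square)
    qed
    show "uniform_limit (cball 0 R) (\<lambda>h. eval_entire (Q h))
        (eval_entire (translate_entire c (deriv_entire g))) (at 0)"
      unfolding uniform_limit_iff
    proof (intro allI impI)
      fix e :: real assume e: "e > 0"
      have "\<forall>\<^sub>F h :: complex in at 0. dist h 0 < min 1 (e / B)"
        unfolding eventually_at using e B(1) by (intro exI[of _ "min 1 (e / B)"]) auto
      moreover have "\<forall>\<^sub>F h :: complex in at 0. h \<noteq> 0"
        by (rule eventually_neq_at_within)
      ultimately show "\<forall>\<^sub>F h in at 0. \<forall>z\<in>cball 0 R.
          dist (eval_entire (Q h) z) (eval_entire (translate_entire c (deriv_entire g)) z) < e"
      proof eventually_elim
        case (elim h)
        then have "B * norm h < e"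
          using B(1) by (simp add: field_simps)
        show ?case
          using le_less_trans[OF bound \<open>B * norm h < e\<close>] elim by simp
      qed
    qed
  qed
  have "((\<lambda>h. c + h) \<longlongrightarrow> c + 0) (at 0)"
    by (intro tendsto_intros)
  then have "\<forall>\<^sub>F h in at 0. c + h \<in> U"
    using U(1) Suc.prems by (auto dest: topological_tendstoD)
  then have "\<forall>\<^sub>F h in at 0. Q h \<in> ?N"
    by eventually_elim
      (use Suc in \<open>auto simp: Q_def g_def intro!: entire.subspace_scale entire.subspace_diff
         closed_subspace_closed_span\<close>)
  then have "translate_entire c (deriv_entire g) \<in> ?N"
    by (rule Lim_in_closed_set[rotated 1]) (use lim in auto)
  then show ?case
    by (simp add: g_def)
qed

text \<open>Translation by a point c of \<open>U\<close> maps the closed span of the derivatives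
  into that of the translates, and it is onto, since translation by -c inverts it.\<close>

lemma closure_span_translates_eq_UNIV:
  assumes "closure (entire.span (range (\<lambda>n. (deriv_entire ^^ n) f))) = UNIV"
    and "open U" "U \<noteq> {}"
  shows "closure (entire.span ((\<lambda>c. translate_entire c f) ` U)) = UNIV" (is "?N = _")
proof -
  obtain c where c: "c \<in> U" using assms(3) by blast
  have "closure (entire.span (range (\<lambda>n. (deriv_entire ^^ n) f))) \<subseteq> translate_entire c -` ?N"
    using translate_in_closed_span_translates[OF assms(2) c, of _ f]
    by (intro closed_span_least closed_subspace_vimage continuous_linear_operator_translate
        closed_subspace_closed_span) auto
  moreover have "translate_entire c (translate_entire (- c) g) = g" for g
    by (rule entire_eqI) simp
  ultimately show ?thesis
    using assms(1) by (metis UNIV_I UNIV_eq_I subset_iff vimage_eq)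
qed

text \<open>The linear functional sending f to (T f)(w) is continuous at 0, hence dominated by a
  multiple of the supremum over one disc. At w = 0 this controls the values on monomials.\<close>

lemma eval_continuous_linear_operator_bound:
  assumes T: "continuous_linear_operator scale_entire T"
  shows "\<exists>C S. S > 0 \<and> (\<forall>f B. B > 0 \<longrightarrow> (\<forall>z. norm z \<le> S \<longrightarrow> norm (eval_entire f z) \<le> B) \<longrightarrow>
      norm (eval_entire (T f) w) \<le> C * B)"
proof -
  note T' = continuous_linear_operatorD[OF T]
  obtain U where U: "open U" "0 \<in> U" "U \<subseteq> {g. \<forall>z\<in>{w}. dist (eval_entire g z) (eval_entire 0 z) < 1}"
    using open_entire_ball[of "{w}" 1 0] by auto
  have "open (T -` U)" "0 \<in> T -` U"
    using T'(1,4) U by (auto simp: continuous_on_open_vimage)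
  then obtain R e where e: "e > 0"
    "\<And>g. (\<And>z. norm z \<le> R \<Longrightarrow> dist (eval_entire g z) (eval_entire 0 z) < e) \<Longrightarrow> g \<in> T -` U"
    using open_entireD[of "T -` U" 0] by metis
  \<comment> \<open>\<open>max R 1\<close> instead of \<open>R\<close> keeps the radius positive.
    The factor 2 lets f, rescaled by e / (2 B), satisfy the strict inequality that defines the
    neighbourhood.\<close>
  have "norm (eval_entire (T f) w) \<le> 2 / e * B"
    if B: "B > 0" "\<forall>z. norm z \<le> max R 1 \<longrightarrow> norm (eval_entire f z) \<le> B" for f and B :: real
  proof -
    let ?c = "complex_of_real (e / (2 * B))"
    have "scale_entire ?c f \<in> T -` U"
    proof (rule e(2))
      fix z :: complex assume "norm z \<le> R"
      then have "norm (eval_entire f z) < 2 * B"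
        using B(1) B(2)[rule_format, of z] by linarith
      then show "dist (eval_entire (scale_entire ?c f) z) (eval_entire 0 z) < e"
        using e(1) B(1) by (simp add: norm_mult norm_divide field_simps)
    qed
    then have "norm (?c * eval_entire (T f) w) < 1"
      using U(3) by (auto simp: T'(3))
    then show ?thesis
      using e(1) B(1) by (simp add: norm_mult norm_divide field_simps)
  qed
  then show ?thesis
    by (intro exI[of _ "2 / e"] exI[of _ "max R 1"]) auto
qed

text \<open>Moving T past one derivative contributes one summand a times the next lower derivative.
  On the derivatives of f, T is thus a lowering operator, as a d/dz is on the powers of z.\<close>

lemma intertwining_funpow_deriv:
  assumes T: "continuous_linear_operator scale_entire T"
    and comm: "commutator T deriv_entire = scale_entire a" and "T f = 0"
  shows "T ((deriv_entire ^^ Suc n) f) = scale_entire (a * of_nat (Suc n)) ((deriv_entire ^^ n) f)"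
proof -
  have step: "T (deriv_entire g) = deriv_entire (T g) + scale_entire a g" for g
    using fun_cong[OF comm, of g] by (simp add: commutator_def algebra_simps)
  show ?thesis
  proof (induction n)
    case 0
    have "deriv_entire 0 = 0"
      by (rule entire_eqI) simp
    then show ?case using step[of f] assms(3) by simp
  next
    case (Suc n)
    have "T ((deriv_entire ^^ Suc (Suc n)) f) =
        deriv_entire (T ((deriv_entire ^^ Suc n) f)) + scale_entire a ((deriv_entire ^^ Suc n) f)"
      using step by simp
    also have "\<dots> = scale_entire (a * of_nat (Suc (Suc n))) ((deriv_entire ^^ Suc n) f)"
      unfolding Suc deriv_entire_scale by (rule entire_eqI) (simp add: algebra_simps)
    finally show ?case .
  qed
qed

text \<open>The translate is the exponential series of c d/dz applied to f. T sends each term of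
  positive index to a c times its predecessor, so the series is reproduced.\<close>

lemma translate_kernel_eigenvector:
  assumes T: "continuous_linear_operator scale_entire T"
    and comm: "commutator T deriv_entire = scale_entire a" and "T f = 0"
  shows "T (translate_entire c f) = scale_entire (a * c) (translate_entire c f)"
proof -
  note T' = continuous_linear_operatorD[OF T]
  let ?F = "\<lambda>n. scale_entire (c ^ n / fact n) ((deriv_entire ^^ n) f)"
  have "(\<lambda>n. T (?F n)) sums T (translate_entire c f)"
    by (intro T'(6) translate_sums_derivs)
  moreover have "T (?F 0) = 0"
    using T'(1,3) \<open>T f = 0\<close> by simp
  \<comment> \<open>The term of index 0 is annihilated because T f = 0, which allows the shift of
    the index.\<close>
  ultimately have "(\<lambda>n. T (?F (Suc n))) sums T (translate_entire c f)"
    unfolding sums_def by (subst (asm) filterlim_sequentially_Suc[symmetric])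
      (simp only: sum.lessThan_Suc_shift add_0_left)
  moreover have "T (?F (Suc n)) = scale_entire (a * c) (?F n)" for n
  proof -
    have "c ^ Suc n / fact (Suc n) * (a * of_nat (Suc n)) = a * c * (c ^ n / fact n)"
      by (simp add: field_simps del: of_nat_Suc)
    then show ?thesis
      unfolding T'(3) intertwining_funpow_deriv[OF assms] entire.scale_scale by simp
  qed
  moreover have "(\<lambda>n. scale_entire (a * c) (?F n)) sums scale_entire (a * c) (translate_entire c f)"
    by (intro continuous_linear_operatorD(6)[OF continuous_linear_operator_scale] translate_sums_derivs)
  ultimately show ?thesis
    using sums_unique2 by simp
qed

lemma closure_span_derivs_kernel_eq_UNIV:
  assumes T: "continuous_linear_operator scale_entire T"
    and comm: "commutator T deriv_entire = scale_entire a" and a: "a \<noteq> 0" and f: "T f = 0" "f \<noteq> 0"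
  shows "closure (entire.span (range (\<lambda>n. (deriv_entire ^^ n) f))) = UNIV" (is "?M = _")
proof -
  let ?X = "poly_entire [:0, 1:]"
  note T' = continuous_linear_operatorD[OF T]
  note M = closed_subspace_closed_span[of "range (\<lambda>n. (deriv_entire ^^ n) f)"]
  have derivs: "(deriv_entire ^^ n) f \<in> ?M" for n
    by (rule subsetD[OF closed_span_superset]) simp
  \<comment> \<open>The functional sending g to (T g)(0), taken on monomials. It does not depend on
    the point w, so the same coefficients \<psi> n / n! express a z f through the derivatives of f
    everywhere.\<close>
  define \<psi> where "\<psi> n = eval_entire (T (poly_entire (monom 1 n))) 0" for n
  obtain C S where S: "S > 0" "\<forall>f B. B > 0 \<longrightarrow> (\<forall>z. norm z \<le> S \<longrightarrow> norm (eval_entire f z) \<le> B) \<longrightarrow>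
      norm (eval_entire (T f) 0) \<le> C * B"
    using eval_continuous_linear_operator_bound[OF T] by blast
  have "norm (\<psi> n) \<le> C * S ^ n" for n
    unfolding \<psi>_def using S(1)
    by (intro S(2)[rule_format]) (auto simp: poly_monom norm_power intro: power_mono)
  moreover have "(\<lambda>n. (deriv ^^ n) (eval_entire f) w / fact n * \<psi> n)
      sums eval_entire (scale_entire a (mult_entire ?X f)) w" for w
  proof -
    have "(\<lambda>n. T (scale_entire ((deriv ^^ n) (eval_entire f) w / fact n) (poly_entire (monom 1 n))))
        sums T (translate_entire w f)"
      by (intro T'(6) Taylor_sums_entire)
    then have "(\<lambda>n. (deriv ^^ n) (eval_entire f) w / fact n * \<psi> n) sums eval_entire (T (translate_entire w f)) 0"
      unfolding sums_def T'(3) using tendsto_eval_entire[of _ _ _ 0] by (fastforce simp: \<psi>_def)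
    then show ?thesis
      by (simp add: translate_kernel_eigenvector[OF T comm f(1)] mult.assoc)
  qed
  ultimately have "(\<lambda>n. scale_entire (\<psi> n / fact n) ((deriv_entire ^^ n) f)) sums scale_entire a (mult_entire ?X f)"
    using S(1) by (intro derivs_sums_entire)
  then have "scale_entire a (mult_entire ?X f) \<in> ?M"
    by (rule closed_subspace_sums[OF M, rotated]) (intro entire.subspace_scale M derivs)
  from entire.subspace_scale[OF M(2) this, of "1 / a"] have Xf: "mult_entire ?X f \<in> ?M"
    using a by simp
  have DM: "deriv_entire g \<in> ?M" if "g \<in> ?M" for g
  proof -
    have "?M \<subseteq> deriv_entire -` ?M"
      by (intro closed_span_least closed_subspace_vimage continuous_linear_operator_deriv M)
        (use derivs[of "Suc _"] in auto)
    with that show ?thesis by blast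
  qed
  have "mult_entire ?X ((deriv_entire ^^ n) f) \<in> ?M" for n
  proof (induction n)
    case (Suc n)
    \<comment> \<open>Leibniz' rule, solved for the term with the higher derivative.\<close>
    have "mult_entire ?X ((deriv_entire ^^ Suc n) f) =
        deriv_entire (mult_entire ?X ((deriv_entire ^^ n) f)) - (deriv_entire ^^ n) f"
      by (simp add: deriv_entire_mult_X)
    then show ?case
      using DM[OF Suc] derivs[of n] by (simp only: entire.subspace_diff[OF M(2)])
  qed (use Xf in simp)
  then have XM: "?M \<subseteq> mult_entire ?X -` ?M"
    by (intro closed_span_least closed_subspace_vimage continuous_linear_operator_mult M) auto
  show ?thesis
    by (rule closed_ideal_deriv_invariant_eq_UNIV[OF M derivs[of 0, simplified] f(2)]) (use DM XM in auto)
qed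

section \<open>Baire category and hypercyclicity\<close>

text \<open>Completeness of H(C): the pointwise limit is uniform on every disc, hence entire by
  Weierstrass' theorem.\<close>

lemma entire_Cauchy_convergent:
  assumes "\<And>R. uniformly_Cauchy_on (cball 0 R) (\<lambda>n. eval_entire (F n))"
  obtains f where "F \<longlonglongrightarrow> f"
proof -
  define g where "g = (\<lambda>z. lim (\<lambda>n. eval_entire (F n) z))"
  have ul: "uniform_limit (cball 0 R) (\<lambda>n. eval_entire (F n)) g sequentially" for R
    using Cauchy_uniformly_convergent[OF assms[of R]]
    unfolding uniformly_convergent_uniform_limit_iff g_def .
  have "g holomorphic_on UNIV"
  proof (rule holomorphic_uniform_sequence)
    fix x :: complex
    have "cball x 1 \<subseteq> cball 0 (norm x + 1)"
      by (rule subset_trans[OF cball_subset_cball_iff[THEN iffD2] order_refl]) auto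
    then have "uniform_limit (cball x 1) (\<lambda>n. eval_entire (F n)) g sequentially"
      by (rule uniform_limit_on_subset[OF ul])
    then show "\<exists>d>0. cball x d \<subseteq> UNIV \<and> uniform_limit (cball x d) (\<lambda>n. eval_entire (F n)) g sequentially"
      by (intro exI[of _ 1]) auto
  qed auto
  then have "eval_entire (Entire g) = g"
    by (simp add: Entire_inverse)
  then show thesis
    using ul that[of "Entire g"] by (simp add: tendsto_entire_cball)
qed

lemma closure_eq_UNIV_iff:
  fixes S :: "'a::topological_space set"
  shows "closure S = UNIV \<longleftrightarrow> (\<forall>U. open U \<longrightarrow> U \<noteq> {} \<longrightarrow> (\<exists>x\<in>U. x \<in> S))"
proof
  assume "closure S = UNIV"
  then show "\<forall>U. open U \<longrightarrow> U \<noteq> {} \<longrightarrow> (\<exists>x\<in>U. x \<in> S)"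
    using open_Int_closure_eq_empty[of _ S] by (metis Int_UNIV_right disjoint_iff)
next
  assume *: "\<forall>U. open U \<longrightarrow> U \<noteq> {} \<longrightarrow> (\<exists>x\<in>U. x \<in> S)"
  have "open (- closure S)" "\<not> (\<exists>x\<in>- closure S. x \<in> S)"
    using closure_subset[of S] by auto
  with * have "- closure S = {}"
    by blast
  then show "closure S = UNIV"
    by blast
qed

text \<open>Nested balls for the supremum over a disc. The k-th ball has tolerance at most 1/2^k and
  disc radius at least k, so the centres form a Cauchy sequence on every disc.\<close>

lemma Baire_entire:
  fixes G :: "nat \<Rightarrow> entire set"
  assumes op: "\<And>k. open (G k)" and dense: "\<And>k. closure (G k) = UNIV"
  shows "(\<Inter>k. G k) \<noteq> {}"
proof -
  \<comment> \<open>The non-strict bound survives pointwise limits, so the limit of the centres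
    remains in every ball.\<close>
  define N where "N = (\<lambda>(f, R, e). {g. \<forall>z. norm z \<le> R \<longrightarrow> dist (eval_entire g z) (eval_entire f z) \<le> e})"
  define P where "P = (\<lambda>k (f, R, e). 0 < e \<and> e \<le> (1 / 2) ^ k \<and> real k \<le> R \<and> N (f, R, e) \<subseteq> G k)"
  have ex: "\<exists>s. P k s \<and> N s \<subseteq> V" if V: "open V" "V \<noteq> {}" for k V
  proof -
    obtain f where f: "f \<in> V" "f \<in> G k"
      using dense[of k] V unfolding closure_eq_UNIV_iff by blast
    then obtain R e where e: "e > 0"
      "\<And>g. (\<And>z. norm z \<le> R \<Longrightarrow> dist (eval_entire g z) (eval_entire f z) < e) \<Longrightarrow> g \<in> V \<inter> G k"
      using open_entireD[of "V \<inter> G k" f] V(1) op[of k] by (metis IntI open_Int)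
    define R' where "R' = max R (real k)"
    define e' where "e' = min (e / 2) ((1 / 2) ^ k)"
    have "N (f, R', e') \<subseteq> V \<inter> G k"
    proof
      fix g assume "g \<in> N (f, R', e')"
      then have "dist (eval_entire g z) (eval_entire f z) \<le> e / 2" if "norm z \<le> R" for z
        using that by (auto simp: N_def R'_def e'_def)
      then show "g \<in> V \<inter> G k"
        using e by (intro e(2)) (smt (verit) field_sum_of_halves)
    qed
    then show ?thesis
      using e(1) by (intro exI[of _ "(f, R', e')"]) (auto simp: P_def e'_def R'_def)
  qed
  have "\<exists>s. \<forall>k. P k (s k) \<and> N (s (Suc k)) \<subseteq> N (s k)"
  proof (rule dependent_nat_choice)
    show "\<exists>s. P 0 s"
      using ex[of UNIV 0] by auto
    fix s k assume s: "P k s"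
    obtain f R e where fRe: "s = (f, R, e)"
      by (cases s) auto
    then have "e > 0"
      using s by (simp add: P_def)
    \<comment> \<open>The next ball is chosen inside a neighbourhood of the present centre, which
      gives the nesting.\<close>
    then obtain U where "open U" "f \<in> U"
      "\<And>g z. g \<in> U \<Longrightarrow> norm z \<le> R \<Longrightarrow> dist (eval_entire g z) (eval_entire f z) < e"
      using open_entire_cball by blast
    then have "open U" "U \<noteq> {}" "U \<subseteq> N s"
      by (auto simp: fRe N_def less_imp_le)
    then show "\<exists>t. P (Suc k) t \<and> N t \<subseteq> N s"
      using ex[of U "Suc k"] by blast
  qed
  then obtain s where s: "\<And>k. P k (s k)" "\<And>k. N (s (Suc k)) \<subseteq> N (s k)"
    by blast
  define f where "f = (\<lambda>k. fst (s k))"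
  have "f m \<in> N (s m)" for m
    using s(1)[of m] by (cases "s m") (auto simp: f_def P_def N_def)
  then have f_N: "f m \<in> N (s n)" if "n \<le> m" for m n
    using lift_Suc_antimono_le[of "\<lambda>k. N (s k)", OF s(2) that] by blast
  have close: "dist (eval_entire (f m) z) (eval_entire (f n) z) \<le> (1 / 2) ^ n"
    if "n \<le> m" "norm z \<le> real n" for m n z
  proof -
    obtain h R e where hRe: "s n = (h, R, e)"
      by (cases "s n") auto
    have "e \<le> (1 / 2) ^ n" "norm z \<le> R" "f n = h"
      using s(1)[of n] that(2) by (auto simp: P_def hRe f_def)
    moreover have "\<forall>z. norm z \<le> R \<longrightarrow> dist (eval_entire (f m) z) (eval_entire h z) \<le> e"
      using f_N[OF that(1)] by (simp add: N_def hRe)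
    ultimately show ?thesis
      by (meson order_trans)
  qed
  have "uniformly_Cauchy_on (cball 0 R) (\<lambda>n. eval_entire (f n))" for R
    unfolding uniformly_Cauchy_on_def
  proof (intro allI impI)
    fix e :: real assume e: "e > 0"
    obtain n1 where n1: "(1 / 2 :: real) ^ n1 < e / 2"
      using real_arch_pow_inv[of "e / 2" "1 / 2"] e by auto
    obtain n2 where n2: "R \<le> real n2"
      using real_arch_simple by blast
    define n where "n = max n1 n2"
    have n: "(1 / 2 :: real) ^ n < e / 2" "R \<le> real n"
    proof -
      have "(1 / 2 :: real) ^ n \<le> (1 / 2) ^ n1"
        by (rule power_decreasing) (auto simp: n_def)
      then show "(1 / 2 :: real) ^ n < e / 2"
        using n1 by linarith
    qed (use n2 in \<open>simp add: n_def\<close>)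
    have "dist (eval_entire (f m) z) (eval_entire (f m') z) < e"
      if "z \<in> cball 0 R" "m \<ge> n" "m' \<ge> n" for z m m'
      using close[OF that(2), of z] close[OF that(3), of z] that(1) n
        dist_triangle2[of "eval_entire (f m) z" "eval_entire (f m') z" "eval_entire (f n) z"] by simp
    then show "\<exists>M. \<forall>z\<in>cball 0 R. \<forall>m\<ge>M. \<forall>m'\<ge>M. dist (eval_entire (f m) z) (eval_entire (f m') z) < e"
      by blast
  qed
  then obtain x where x: "f \<longlonglongrightarrow> x"
    using entire_Cauchy_convergent by blast
  have "x \<in> G k" for k
  proof -
    obtain h R e where hRe: "s k = (h, R, e)"
      by (cases "s k") auto
    have "dist (eval_entire x z) (eval_entire h z) \<le> e" if "norm z \<le> R" for z
    proof (rule tendsto_upperbound)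
      show "((\<lambda>m. dist (eval_entire (f m) z) (eval_entire h z)) \<longlongrightarrow>
          dist (eval_entire x z) (eval_entire h z)) sequentially"
        by (intro tendsto_intros tendsto_eval_entire x)
      show "\<forall>\<^sub>F m in sequentially. dist (eval_entire (f m) z) (eval_entire h z) \<le> e"
        using f_N[of k] that unfolding eventually_sequentially by (auto simp: hRe N_def)
    qed simp
    then have "x \<in> N (s k)"
      by (simp add: hRe N_def)
    then show ?thesis
      using s(1)[of k] by (auto simp: hRe P_def)
  qed
  then show ?thesis
    by blast
qed

text \<open>Taylor polynomials approximate on discs, and their finitely many coefficients can be
  moved slightly into a countable dense set of scalars.\<close>

lemma countable_dense_entire:
  obtains D :: "entire set" where "countable D" "closure D = UNIV"
proof -
  obtain Q :: "complex set" where Q: "countable Q" "\<And>X. open X \<Longrightarrow> X \<noteq> {} \<Longrightarrow> \<exists>d\<in>Q. d \<in> X"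
    using countable_dense_exists by blast
  \<comment> \<open>\<open>Pi\<^sub>E\<close> fixes the coefficient families outside the index
    range, so that there are only countably many.\<close>
  define D where "D = (\<Union>n. (\<lambda>q. poly_entire (\<Sum>i<n. monom (q i) i)) ` (Pi\<^sub>E {..<n} (\<lambda>_. Q)))"
  have "countable D"
    unfolding D_def using Q(1) by (intro countable_UN countable_image countable_PiE) auto
  moreover have "f \<in> closure D" for f
    unfolding closure_entire_iff
  proof (intro allI impI)
    fix R e :: real assume e: "e > 0"
    define c where "c = (\<lambda>i. (deriv ^^ i) (eval_entire f) 0 / fact i)"
    have "uniform_limit (cball 0 R) (\<lambda>n z. \<Sum>i<n. c i * z ^ i) (eval_entire f) sequentially"
      unfolding c_def by (rule uniform_limit_Taylor_0[of _ "R + 1"]) auto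
    then have "\<forall>\<^sub>F n in sequentially. \<forall>z\<in>cball 0 R. dist (\<Sum>i<n. c i * z ^ i) (eval_entire f z) < e / 2"
      using half_gt_zero[OF e] unfolding uniform_limit_iff by blast
    then obtain n where n: "\<forall>z\<in>cball 0 R. dist (\<Sum>i<n. c i * z ^ i) (eval_entire f z) < e / 2"
      using eventually_happens'[OF sequentially_bot] by blast
    \<comment> \<open>Measures how errors in the coefficients add up on the disc; the summand 1
      keeps it positive when the sum is empty.\<close>
    define b where "b = (\<Sum>i<n. \<bar>R\<bar> ^ i) + 1"
    have b: "b > 0"
      unfolding b_def by (intro add_nonneg_pos sum_nonneg) auto
    define \<delta> where "\<delta> = e / 2 / b"
    have \<delta>: "\<delta> > 0"
      using e b by (simp add: \<delta>_def)
    have "\<exists>q\<in>Q. dist (c i) q < \<delta>" for i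
      using Q(2)[of "ball (c i) \<delta>"] \<delta> by auto
    then obtain q where q: "\<And>i. q i \<in> Q" "\<And>i. dist (c i) (q i) < \<delta>"
      by metis
    define g where "g = poly_entire (\<Sum>i<n. monom (restrict q {..<n} i) i)"
    have g: "eval_entire g z = (\<Sum>i<n. q i * z ^ i)" for z
      by (simp add: g_def poly_sum poly_monom)
    have "restrict q {..<n} \<in> Pi\<^sub>E {..<n} (\<lambda>_. Q)"
      using q(1) by auto
    then have "g \<in> D"
      unfolding g_def D_def by blast
    moreover have "dist (eval_entire g z) (eval_entire f z) < e" if z: "norm z \<le> R" for z
    proof -
      have "dist (eval_entire g z) (\<Sum>i<n. c i * z ^ i) = norm (\<Sum>i<n. (q i - c i) * z ^ i)"
        by (simp add: g dist_norm left_diff_distrib sum_subtractf)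
      also have "\<dots> \<le> (\<Sum>i<n. \<delta> * \<bar>R\<bar> ^ i)"
      proof (rule sum_norm_le)
        fix i
        show "norm ((q i - c i) * z ^ i) \<le> \<delta> * \<bar>R\<bar> ^ i"
          unfolding norm_mult norm_power using q(2)[of i] z \<delta>
          by (intro mult_mono power_mono) (auto simp: dist_norm norm_minus_commute)
      qed
      also have "\<dots> \<le> \<delta> * b"
        using \<delta> unfolding sum_distrib_left[symmetric] by (intro mult_left_mono) (auto simp: b_def)
      also have "\<dots> = e / 2"
        using b by (simp add: \<delta>_def)
      finally have "dist (eval_entire g z) (\<Sum>i<n. c i * z ^ i) \<le> e / 2" .
      moreover have "dist (\<Sum>i<n. c i * z ^ i) (eval_entire f z) < e / 2"
        using n z by simp
      ultimately show ?thesis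
        using dist_triangle[of "eval_entire g z" "eval_entire f z" "\<Sum>i<n. c i * z ^ i"] by linarith
    qed
    ultimately show "\<exists>g\<in>D. \<forall>z. norm z \<le> R \<longrightarrow> dist (eval_entire g z) (eval_entire f z) < e"
      by blast
  qed
  ultimately show thesis
    using that[of D] by blast
qed

section \<open>Transitivity and the eigenvector criterion for hypercyclicity\<close>

lemma continuous_linear_operator_funpow:
  assumes "continuous_linear_operator scale_entire A"
  shows "continuous_linear_operator scale_entire (A ^^ n)"
proof (induction n)
  case 0
  show ?case
    by (auto simp: continuous_linear_operator_def intro: linear_scale_entireI)
next
  case (Suc n)
  then show ?case
    using assms Vector_Spaces.linear_compose[of scale_entire scale_entire "A ^^ n" scale_entire A]
      continuous_on_compose[of UNIV "A ^^ n" A] continuous_on_subset[of UNIV A]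
    unfolding continuous_linear_operator_def funpow.simps by blast
qed

text \<open>Birkhoff's argument: for each of countably many test neighbourhoods, the points whose
  orbit meets it form an open dense set, and by Baire some point lies in all of these sets.\<close>

lemma hypercyclic_if_transitive:
  assumes A: "continuous_linear_operator scale_entire A"
    and trans: "\<And>U V. open U \<Longrightarrow> U \<noteq> {} \<Longrightarrow> open V \<Longrightarrow> V \<noteq> {} \<Longrightarrow> \<exists>n. \<exists>x\<in>U. (A ^^ n) x \<in> V"
  shows "hypercyclic scale_entire A"
proof -
  obtain D :: "entire set" where D: "countable D" "closure D = UNIV"
    using countable_dense_entire by blast
  \<comment> \<open>A single index \<open>m\<close> governs both the growing disc and the shrinking
    tolerance, so countably many neighbourhoods of each \<open>y\<close> suffice.\<close>
  have "\<exists>W. \<forall>y m. open (W y m) \<and> y \<in> W y m \<and>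
      W y m \<subseteq> {g. \<forall>z\<in>cball 0 (real m). dist (eval_entire g z) (eval_entire y z) < 1 / real (Suc m)}"
    by (rule choice, rule allI, rule choice, rule allI, rule open_entire_ball) auto
  then obtain W where W: "\<And>y m. open (W y m)" "\<And>y m. y \<in> W y m"
    "\<And>y m. W y m \<subseteq> {g. \<forall>z\<in>cball 0 (real m). dist (eval_entire g z) (eval_entire y z) < 1 / real (Suc m)}"
    by blast
  have ne: "D \<times> (UNIV :: nat set) \<noteq> {}"
    using D(2) by auto
  have cnt: "countable (D \<times> (UNIV :: nat set))"
    using D(1) by simp
  define p where "p = from_nat_into (D \<times> (UNIV :: nat set))"
  define G where "G = (\<lambda>k. \<Union>n. (A ^^ n) -` W (fst (p k)) (snd (p k)))"
  have "(\<Inter>k. G k) \<noteq> {}"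
  proof (rule Baire_entire)
    show "open (G k)" for k
      unfolding G_def
      using continuous_linear_operatorD(4)[OF continuous_linear_operator_funpow[OF A]] W(1)
      by (auto simp: continuous_on_open_vimage)
    show "closure (G k) = UNIV" for k
      unfolding closure_eq_UNIV_iff
    proof (intro allI impI)
      fix U :: "entire set" assume "open U" "U \<noteq> {}"
      moreover have "W (fst (p k)) (snd (p k)) \<noteq> {}"
        using W(2) by (metis empty_iff)
      ultimately obtain n x where "x \<in> U" "(A ^^ n) x \<in> W (fst (p k)) (snd (p k))"
        using trans W(1) by meson
      then show "\<exists>x\<in>U. x \<in> G k"
        by (auto simp: G_def)
    qed
  qed
  then obtain x where x: "x \<in> G k" for k
    by blast
  have "y \<in> closure (range (\<lambda>n. (A ^^ n) x))" if y: "y \<in> D" for y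
    unfolding closure_entire_iff
  proof (intro allI impI)
    fix R e :: real assume e: "e > 0"
    obtain m1 where m1: "R \<le> real m1"
      using real_arch_simple by blast
    obtain m2 where m2: "1 / real (Suc m2) < e"
      using e nat_approx_posE by blast
    define m where "m = max m1 m2"
    have m: "R \<le> real m" "1 / real (Suc m) < e"
      using m1 m2 frac_le[of 1 1 "real (Suc m2)" "real (Suc m)"] by (auto simp: m_def)
    obtain k where "p k = (y, m)"
      using from_nat_into_surj[OF cnt, of "(y, m)"] y by (auto simp: p_def)
    then obtain n where "(A ^^ n) x \<in> W y m"
      using x[of k] by (auto simp: G_def)
    then have "\<forall>z\<in>cball 0 (real m). dist (eval_entire ((A ^^ n) x) z) (eval_entire y z) < 1 / real (Suc m)"
      using subsetD[OF W(3)] by blast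
    then have "\<forall>z. norm z \<le> R \<longrightarrow> dist (eval_entire ((A ^^ n) x) z) (eval_entire y z) < e"
      using m by (meson less_trans mem_cball_0 order_trans)
    then show "\<exists>g\<in>range (\<lambda>n. (A ^^ n) x). \<forall>z. norm z \<le> R \<longrightarrow> dist (eval_entire g z) (eval_entire y z) < e"
      by blast
  qed
  then have "closure D \<subseteq> closure (range (\<lambda>n. (A ^^ n) x))"
    by (intro closure_minimal) auto
  then show ?thesis
    using A D(2) unfolding hypercyclic_def by blast
qed

text \<open>Orbits of eigenvectors with |\<mu>| < 1 tend to 0, and so do suitable preimages of
  eigenvectors with |\<mu>| > 1; both properties pass to linear combinations. For x in
  \<open>U\<close> of the first kind and y in \<open>V\<close> with preimages \<open>s n\<close>
  tending to 0, the points x + \<open>s n\<close> tend to x while their n-th images tend to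
  y.\<close>

lemma Godefroy_Shapiro_entire:
  assumes A: "continuous_linear_operator scale_entire A"
    and small: "closure (entire.span {x. \<exists>\<mu>. norm \<mu> < 1 \<and> A x = scale_entire \<mu> x}) = UNIV"
    and large: "closure (entire.span {x. \<exists>\<mu>. norm \<mu> > 1 \<and> A x = scale_entire \<mu> x}) = UNIV"
  shows "hypercyclic scale_entire A"
proof (rule hypercyclic_if_transitive[OF A])
  fix U V :: "entire set"
  assume U: "open U" "U \<noteq> {}" and V: "open V" "V \<noteq> {}"
  note An = continuous_linear_operatorD[OF continuous_linear_operator_funpow[OF A]]
  have eigen: "(A ^^ n) x = scale_entire (\<mu> ^ n) x" if "A x = scale_entire \<mu> x" for n x \<mu>
    by (induction n) (auto simp: continuous_linear_operatorD(3)[OF A] that mult.commute)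
  define X where "X = {x. (\<lambda>n. (A ^^ n) x) \<longlonglongrightarrow> 0}"
  \<comment> \<open>Only a sequence of preimages is recorded, \<open>s n\<close> under the n-th
    power of \<open>A\<close>, so no right inverse of \<open>A\<close> has to be
    constructed.\<close>
  define Y where "Y = {y. \<exists>s. s \<longlonglongrightarrow> 0 \<and> (\<forall>n. (A ^^ n) (s n) = y)}"
  have "entire.subspace X"
    unfolding entire.subspace_def X_def
    using tendsto_add[of _ "0 :: entire" sequentially _ 0]
      tendsto_scale_entire[OF tendsto_const, of _ 0 sequentially]
    by (auto simp: An)
  moreover have "{x. \<exists>\<mu>. norm \<mu> < 1 \<and> A x = scale_entire \<mu> x} \<subseteq> X"
  proof clarify
    fix x \<mu> assume \<mu>: "norm \<mu> < 1" "A x = scale_entire \<mu> x"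
    have "(\<lambda>n. scale_entire (\<mu> ^ n) x) \<longlonglongrightarrow> scale_entire 0 x"
      by (intro tendsto_scale_entire LIMSEQ_power_zero tendsto_const \<mu>)
    then show "x \<in> X"
      by (simp add: X_def eigen[OF \<mu>(2)])
  qed
  ultimately have "closure X = UNIV"
    using small closure_mono[OF entire.span_minimal] by blast
  then obtain x where x: "x \<in> U" "(\<lambda>n. (A ^^ n) x) \<longlonglongrightarrow> 0"
    using U unfolding closure_eq_UNIV_iff X_def by blast
  have "entire.subspace Y"
    unfolding entire.subspace_def
  proof (intro conjI ballI allI)
    show "0 \<in> Y"
      unfolding Y_def by (auto intro!: exI[of _ "\<lambda>_. 0"] simp: An)
    fix y c assume "y \<in> Y"
    then obtain s where s: "s \<longlonglongrightarrow> 0" "\<And>n. (A ^^ n) (s n) = y"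
      unfolding Y_def by blast
    then show "scale_entire c y \<in> Y"
      using tendsto_scale_entire[OF tendsto_const s(1), of c]
      by (auto intro!: exI[of _ "\<lambda>n. scale_entire c (s n)"] simp: An Y_def)
    fix y' assume "y' \<in> Y"
    then obtain s' where s': "s' \<longlonglongrightarrow> 0" "\<And>n. (A ^^ n) (s' n) = y'"
      unfolding Y_def by blast
    show "y + y' \<in> Y"
      using tendsto_add[OF s(1) s'(1)]
      by (auto intro!: exI[of _ "\<lambda>n. s n + s' n"] simp: An Y_def s s')
  qed
  moreover have "{x. \<exists>\<mu>. norm \<mu> > 1 \<and> A x = scale_entire \<mu> x} \<subseteq> Y"
  proof clarify
    fix y \<mu> assume y: "norm \<mu> > 1" "A y = scale_entire \<mu> y"
    have "norm (1 / \<mu>) < 1"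
      using y(1) by (simp add: norm_divide divide_simps)
    then have "(\<lambda>n. scale_entire ((1 / \<mu>) ^ n) y) \<longlonglongrightarrow> scale_entire 0 y"
      by (intro tendsto_scale_entire LIMSEQ_power_zero tendsto_const)
    moreover have "\<mu> \<noteq> 0"
      using y(1) by auto
    then have "(A ^^ n) (scale_entire ((1 / \<mu>) ^ n) y) = y" for n
      by (simp add: An eigen[OF y(2)] power_one_over)
    ultimately show "y \<in> Y"
      by (auto simp: Y_def)
  qed
  ultimately have "closure Y = UNIV"
    using large closure_mono[OF entire.span_minimal] by blast
  then obtain y s where y: "y \<in> V" "s \<longlonglongrightarrow> 0" "\<And>n. (A ^^ n) (s n) = y"
    using V unfolding closure_eq_UNIV_iff Y_def by blast
  have "(\<lambda>n. x + s n) \<longlonglongrightarrow> x"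
    using tendsto_add[OF tendsto_const y(2), of x] by simp
  then have "\<forall>\<^sub>F n in sequentially. x + s n \<in> U"
    using U(1) x(1) by (rule topological_tendstoD)
  moreover have "(\<lambda>n. (A ^^ n) (x + s n)) \<longlonglongrightarrow> y"
    using tendsto_add[OF x(2) tendsto_const, of y] by (simp add: An y(3))
  then have "\<forall>\<^sub>F n in sequentially. (A ^^ n) (x + s n) \<in> V"
    using V(1) y(1) by (rule topological_tendstoD)
  ultimately have "\<forall>\<^sub>F n in sequentially. x + s n \<in> U \<and> (A ^^ n) (x + s n) \<in> V"
    by (rule eventually_conj)
  then show "\<exists>n. \<exists>x\<in>U. (A ^^ n) x \<in> V"
    using eventually_happens'[OF sequentially_bot] by blast
qed

section \<open>Functions of the operator\<close>

text \<open>On an eigenvector the operator series collapses to the scalar Taylor series of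
  \<open>L\<close> at 0, evaluated at \<mu>, which converges because \<open>L\<close> is
  entire.\<close>

lemma entire_of_op_eigenvector:
  assumes L: "L holomorphic_on UNIV" and T: "continuous_linear_operator scale_entire T"
    and x: "T x = scale_entire \<mu> x"
  shows "entire_of_op L T x = scale_entire (L \<mu>) x"
proof -
  have pow: "(T ^^ n) x = scale_entire (\<mu> ^ n) x" for n
    by (induction n) (auto simp: continuous_linear_operatorD(3)[OF T] x mult.commute)
  have "(\<lambda>n. (deriv ^^ n) L 0 / fact n * \<mu> ^ n) sums L \<mu>"
    using holomorphic_power_series[of L 0 "norm \<mu> + 1" \<mu>] holomorphic_on_subset[OF L] by simp
  then have "(\<lambda>n. scale_entire (\<Sum>k<n. (deriv ^^ k) L 0 / fact k * \<mu> ^ k) x) \<longlonglongrightarrow> scale_entire (L \<mu>) x"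
    unfolding sums_def by (intro tendsto_scale_entire tendsto_const)
  then have "op_series_term L T x sums scale_entire (L \<mu>) x"
    by (simp add: sums_def op_series_term_def fps_expansion_def pow entire.scale_sum_left)
  then show ?thesis
    unfolding entire_of_op_def by (simp add: sums_iff)
qed

text \<open>Liouville's theorem, applied to \<open>L\<close> and to its reciprocal; the latter would
  be entire and bounded by 1 if \<open>L\<close> avoided the open unit disc.\<close>

lemma nonconstant_entire_norm_less_and_greater:
  assumes L: "L holomorphic_on UNIV" and nc: "\<not> L constant_on UNIV"
  shows "\<exists>z. norm (L z) < 1" "\<exists>z. norm (L z) > 1"
proof -
  show "\<exists>z. norm (L z) > 1"
  proof (rule ccontr)
    assume "\<nexists>z. norm (L z) > 1"
    then have "bounded (range L)"
      by (auto simp: bounded_iff not_less)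
    with Liouville_theorem[OF L] nc show False by blast
  qed
  show "\<exists>z. norm (L z) < 1"
  proof (rule ccontr)
    assume "\<nexists>z. norm (L z) < 1"
    then have ge: "norm (L z) \<ge> 1" for z
      by (simp add: not_less)
    then have nz: "L z \<noteq> 0" for z
      by (metis norm_zero not_one_le_zero)
    have "(\<lambda>z. inverse (L z)) holomorphic_on UNIV"
      using L nz by (intro holomorphic_intros) auto
    moreover have "norm (inverse (L z)) \<le> 1" for z
      using ge[of z] by (simp add: norm_inverse inverse_le_1_iff)
    then have "bounded (range (\<lambda>z. inverse (L z)))"
      by (auto simp: bounded_iff)
    ultimately have "(\<lambda>z. inverse (L z)) constant_on UNIV"
      by (rule Liouville_theorem)
    then have "L constant_on UNIV"
      unfolding constant_on_def by (metis inverse_inverse_eq)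
    with nc show False ..
  qed
qed

theorem theorem1p3:
  fixes T :: "entire \<Rightarrow> entire" and a :: complex and L :: "complex \<Rightarrow> complex"
  assumes "continuous_linear_operator scale_entire T"
    and "{f. T f = 0} \<noteq> {0}"
    and "a \<noteq> 0"
    and "commutator T deriv_entire = scale_entire a"
    and "L holomorphic_on UNIV"
    and "\<not> L constant_on UNIV"
    and "\<And>f. summable (op_series_term L T f)"
    and "continuous_linear_operator scale_entire (entire_of_op L T)"
  shows "hypercyclic scale_entire (entire_of_op L T)"
proof -
  have "T 0 = 0"
    by (rule continuous_linear_operatorD[OF assms(1)])
  then obtain f where f: "T f = 0" "f \<noteq> 0"
    using assms(2) by blast
  let ?E = "\<lambda>\<mu> x. entire_of_op L T x = scale_entire \<mu> x"
  have eigen: "?E (L (a * c)) (translate_entire c f)" for c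
    by (intro entire_of_op_eigenvector translate_kernel_eigenvector assms f)
  \<comment> \<open>To be used with \<open>S\<close> the open unit disc and the exterior of the
    closed one. The parameters c with L(a c) in \<open>S\<close> form an open set, and their
    translates are eigenvectors with eigenvalues in \<open>S\<close>.\<close>
  have dense: "closure (entire.span {x. \<exists>\<mu>. \<mu> \<in> S \<and> ?E \<mu> x}) = UNIV"
    if S: "open S" and z: "L z \<in> S" for S z
  proof -
    let ?U = "(\<lambda>c. L (a * c)) -` S"
    have "continuous_on UNIV (\<lambda>c. L (a * c))"
      by (rule continuous_on_compose2[OF holomorphic_on_imp_continuous_on[OF assms(5)]])
         (auto intro: continuous_intros)
    then have "open ?U"
      using S by (rule open_vimage[rotated])
    \<comment> \<open>Since a is nonzero, a c runs through the whole plane, so every value of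
      \<open>L\<close> is attained.\<close>
    moreover have "z / a \<in> ?U"
      using z assms(3) by simp
    then have "?U \<noteq> {}"
      by blast
    ultimately have "closure (entire.span ((\<lambda>c. translate_entire c f) ` ?U)) = UNIV"
      by (intro closure_span_translates_eq_UNIV closure_span_derivs_kernel_eq_UNIV[OF assms(1,4,3) f])
    moreover have "(\<lambda>c. translate_entire c f) ` ?U \<subseteq> {x. \<exists>\<mu>. \<mu> \<in> S \<and> ?E \<mu> x}"
      using eigen by auto
    note closure_mono[OF entire.span_mono[OF this]]
    ultimately show ?thesis
      by blast
  qed
  obtain z1 z2 where "norm (L z1) < 1" "norm (L z2) > 1"
    using nonconstant_entire_norm_less_and_greater[OF assms(5,6)] by blast
  moreover have "open {\<mu> :: complex. norm \<mu> < 1}" "open {\<mu> :: complex. norm \<mu> > 1}"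
    by (auto intro!: open_Collect_less continuous_intros)
  ultimately show ?thesis
    using dense[of "{\<mu>. norm \<mu> < 1}" z1] dense[of "{\<mu>. norm \<mu> > 1}" z2]
    by (intro Godefroy_Shapiro_entire[OF assms(8)]) auto
qed

end
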